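(* Let $A$ be a formal manifold that admits an i-affine structure on its second-order i-structure $A_2$. Then $A$ admits a symmetric affine connection on points.
   Context: Setting: naive axiomatic Synthetic Differential Geometry, i.e. one argues intuitionistically (in the internal logic of a topos); "space" means a set/object of this universe and "map" an arbitrary map. $R$ is a commutative ring which is a $\mathbb{Q}$-algebra. For $k,n\ge 1$ let $D_k(n)=\{(d_1,\dots,d_n)\in R^n \mid \text{any product of } k+1 \text{ of the } d_j \text{ (repetitions allowed) vanishes}\}$. $R$ is assumed to satisfy the Kock–Lawvere axiom for all $D_k(n)$, $k,n\ge1$: every map $t:D_k(n)\to R$ is given by a uniquely determined polynomial in $R[X_1,\dots,X_n]$ of total degree $\le k$. A subspace (injective map) $U\hookrightarrow X$ is formally open if it is stable under infinitesimal perturbations: for all $k,m\ge1$ every map $t:D_k(m)\to X$ with $t(0)\in U$ takes all its values in $U$ (for $X=R^n$: $P\in U$ and $d\in D_k(n)$ imply $P+d\in U$). A chart of a space $A$ is a formally open subspace $\iota:U\hookrightarrow A$ that is also a formally open subspace $\varphi:U\hookrightarrow R^n$. A formal manifold (of dimension $n$) is a space $A$ that is covered by (i.e. is the union of) its charts into $R^n$. An i-structure on a space $A$ is a family of subsets $A\langle p\rangle\subseteq A^p$ ($p\in\mathbb{N}$) such that (1) $A\langle 1\rangle=A$, $A\langle 0\rangle=A^0=1$; (2) for every map $h:\{1,\dots,m\}\to\{1,\dots,p\}$ and every $(P_1,\dots,P_p)\in A\langle p\rangle$ one has $(P_{h(1)},\dots,P_{h(m)})\in A\langle m\rangle$. For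 $V=R^n$ put $\mathrm{DN}_k(V)=\{(v_1,\dots,v_{k+1})\in D_k(n)^{k+1}\mid \phi(v_1,\dots,v_{k+1})=0 \text{ for every } (k+1)\text{-linear map } \phi:V^{k+1}\to R\}$. The $k$th-order i-structure on $R^n$ is: $(R^n)_k\langle 1\rangle=R^n$, $(R^n)_k\langle 0\rangle=1$, and for $p\ge 2$, $(R^n)_k\langle p\rangle=\{(P_1,\dots,P_p)\mid (P_{i_1}-P_{j_1},\dots,P_{i_{k+1}}-P_{j_{k+1}})\in \mathrm{DN}_k(V) \text{ for all } i_\ell,j_\ell\in\{1,\dots,p\},\ i_\ell\ne j_\ell\}$. For $U$ formally open in $R^n$, $U_k$ is its restriction (pullback) to $U$. For a formal manifold $A$, $A_k\langle p\rangle$ is the union over all charts $\iota:U\hookrightarrow A$ of the images $\iota^p(U_k\langle p\rangle)$; this is an i-structure. Points $P,Q\in A$ are first-order neighbours if $(P,Q)\in A_1\langle2\rangle$ (in a chart: $Q-P\in D_1(n)$). Let $\mathcal{A}(p)=\{(\lambda_1,\dots,\lambda_p)\in R^p\mid\sum_j\lambda_j=1\}$. An i-affine structure on an i-structure $A\langle-\rangle$ consists of operations $\mathcal{A}(p)\times A\langle p\rangle\to A$, $(\lambda,(P_1,\dots,P_p))\mapsto\sum_j\lambda_jP_j$, $p\in\mathbb{N}$, satisfying: (Neighbourhood) for $\lambda^1,\dots,\lambda^m\in\mathcal{A}(p)$ and $(P_1,\dots,P_p)\in A\langle p\rangle$, $(\sum_j\lambda^1_jP_j,\dots,\sum_j\lambda^m_jP_j)\in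 A\langle m\rangle$; (Associativity) if moreover $\mu\in\mathcal{A}(m)$, then $\sum_{k}\mu_k(\sum_j\lambda^k_jP_j)=\sum_j(\sum_k\mu_k\lambda^k_j)P_j$; (Projection) for $p\ge1$ and $1\le k\le p$, $\sum_j(e^p_k)_jP_j=P_k$, $e^p_k$ being the $k$th standard basis vector. An affine connection (on points) on $A$ is a map $\lambda$ assigning to each triple $(P,Q,S)$ of points of $A$ with $P,Q$ first-order neighbours and $P,S$ first-order neighbours a point $\lambda(P,Q,S)\in A$ such that $\lambda(P,Q,P)=Q$ and $\lambda(P,P,S)=S$. It is symmetric if $\lambda(P,Q,S)=\lambda(P,S,Q)$. *)

theory Defs
  imports Complex_Main "HOL-Algebra.Ring"
begin

text \<open>
  The Kock--Lawvere axiom is incompatible with classical logic (in HOL, read naively, it forces the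
  ring to be trivial).  The statement is therefore interpreted in the internal logic of an arbitrary
  elementary topos, by Kripke--Joyal semantics.  Everything is formulated with generalised elements:
  an element of a space \<open>X\<close> at stage \<open>V\<close> is an arrow \<open>V \<rightarrow> X\<close>, and elements are restricted along
  arrows \<open>W \<rightarrow> V\<close>.  An internal ``for all'' or ``implies'' ranges over all later stages.
  Orders, dimensions and arities (\<open>k\<close>, \<open>n\<close>, \<open>p\<close>, \<open>m\<close>) are standard natural numbers, so no natural
  numbers object is needed.  Tuples are lists and are indexed from 0.
\<close>

section \<open>Elementary toposes\<close>

record ('o, 'a) cat =
  Ob :: "'o set"
  Arr :: "'a set"
  Dom :: "'a \<Rightarrow> 'o"
  Cod :: "'a \<Rightarrow> 'o"
  Ident :: "'o \<Rightarrow> 'a"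
  Comp :: "'a \<Rightarrow> 'a \<Rightarrow> 'a" (infixl "\<cdot>\<index>" 75)

definition Hom :: "('o, 'a) cat \<Rightarrow> 'o \<Rightarrow> 'o \<Rightarrow> 'a set" where
  "Hom C X Y = {f \<in> Arr C. Dom C f = X \<and> Cod C f = Y}"

definition into :: "('o, 'a) cat \<Rightarrow> 'o \<Rightarrow> 'a set" where
  "into C V = {g \<in> Arr C. Cod C g = V}"

locale category =
  fixes C :: "('o, 'a) cat" (structure)
  assumes Dom_Ob: "f \<in> Arr C \<Longrightarrow> Dom C f \<in> Ob C"
    and Cod_Ob: "f \<in> Arr C \<Longrightarrow> Cod C f \<in> Ob C"
    and Ident_Hom: "X \<in> Ob C \<Longrightarrow> Ident C X \<in> Hom C X X"
    and Comp_Hom: "f \<in> Hom C Y Z \<Longrightarrow> g \<in> Hom C X Y \<Longrightarrow> f \<cdot> g \<in> Hom C X Z"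
    and Comp_assoc: "f \<in> Hom C Y Z \<Longrightarrow> g \<in> Hom C X Y \<Longrightarrow> h \<in> Hom C W X \<Longrightarrow>
      (f \<cdot> g) \<cdot> h = f \<cdot> (g \<cdot> h)"
    and Ident_left: "f \<in> Hom C X Y \<Longrightarrow> Ident C Y \<cdot> f = f"
    and Ident_right: "f \<in> Hom C X Y \<Longrightarrow> f \<cdot> Ident C X = f"

definition is_terminal :: "('o, 'a) cat \<Rightarrow> 'o \<Rightarrow> bool" where
  "is_terminal C T \<longleftrightarrow> T \<in> Ob C \<and> (\<forall>X\<in>Ob C. \<exists>!f. f \<in> Hom C X T)"

definition is_mono :: "('o, 'a) cat \<Rightarrow> 'a \<Rightarrow> bool" where
  "is_mono C m \<longleftrightarrow> m \<in> Arr C \<and>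
    (\<forall>T\<in>Ob C. \<forall>u\<in>Hom C T (Dom C m). \<forall>v\<in>Hom C T (Dom C m).
      m \<cdot>\<^bsub>C\<^esub> u = m \<cdot>\<^bsub>C\<^esub> v \<longrightarrow> u = v)"

definition is_pullback :: "('o, 'a) cat \<Rightarrow> 'a \<Rightarrow> 'a \<Rightarrow> 'a \<Rightarrow> 'a \<Rightarrow> bool" where
  "is_pullback C f g p q \<longleftrightarrow>
    f \<in> Arr C \<and> g \<in> Arr C \<and> Cod C f = Cod C g \<and>
    p \<in> Hom C (Dom C p) (Dom C f) \<and> q \<in> Hom C (Dom C p) (Dom C g) \<and>
    f \<cdot>\<^bsub>C\<^esub> p = g \<cdot>\<^bsub>C\<^esub> q \<and>
    (\<forall>T\<in>Ob C. \<forall>a\<in>Hom C T (Dom C f). \<forall>b\<in>Hom C T (Dom C g).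
      f \<cdot>\<^bsub>C\<^esub> a = g \<cdot>\<^bsub>C\<^esub> b \<longrightarrow>
      (\<exists>!u. u \<in> Hom C T (Dom C p) \<and> p \<cdot>\<^bsub>C\<^esub> u = a \<and> q \<cdot>\<^bsub>C\<^esub> u = b))"

(* a subobject of Y x X, given as a jointly monic pair of arrows r into Y and s into X *)
definition is_relation :: "('o, 'a) cat \<Rightarrow> 'o \<Rightarrow> 'o \<Rightarrow> 'a \<Rightarrow> 'a \<Rightarrow> bool" where
  "is_relation C Y X r s \<longleftrightarrow>
    r \<in> Hom C (Dom C r) Y \<and> s \<in> Hom C (Dom C r) X \<and>
    (\<forall>T\<in>Ob C. \<forall>u\<in>Hom C T (Dom C r). \<forall>v\<in>Hom C T (Dom C r).
      r \<cdot>\<^bsub>C\<^esub> u = r \<cdot>\<^bsub>C\<^esub> v \<and> s \<cdot>\<^bsub>C\<^esub> u = s \<cdot>\<^bsub>C\<^esub> v \<longrightarrow> u = v)"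

(* PX with membership relation (e1, e2): every relation from Y to X is the pullback of the
   membership relation along a unique arrow Y -> PX *)
definition is_power_object :: "('o, 'a) cat \<Rightarrow> 'o \<Rightarrow> 'o \<Rightarrow> 'a \<Rightarrow> 'a \<Rightarrow> bool" where
  "is_power_object C X PX e1 e2 \<longleftrightarrow>
    PX \<in> Ob C \<and> is_relation C PX X e1 e2 \<and>
    (\<forall>Y\<in>Ob C. \<forall>r s. is_relation C Y X r s \<longrightarrow>
      (\<exists>!c. c \<in> Hom C Y PX \<and>
        (\<exists>u\<in>Hom C (Dom C r) (Dom C e1). is_pullback C c e1 r u \<and> e2 \<cdot>\<^bsub>C\<^esub> u = s)))"

locale elementary_topos = category +
  assumes has_terminal: "\<exists>T. is_terminal C T"
    and has_pullbacks: "f \<in> Arr C \<Longrightarrow> g \<in> Arr C \<Longrightarrow> Cod C f = Cod C g \<Longrightarrow>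
      \<exists>p q. is_pullback C f g p q"
    and has_power_objects: "X \<in> Ob C \<Longrightarrow> \<exists>PX e1 e2. is_power_object C X PX e1 e2"


section \<open>Internal existence\<close>

definition factors_through :: "('o, 'a) cat \<Rightarrow> 'a \<Rightarrow> 'a \<Rightarrow> bool" where
  "factors_through C m h \<longleftrightarrow> (\<exists>u\<in>Hom C (Dom C h) (Dom C m). m \<cdot>\<^bsub>C\<^esub> u = h)"

text \<open>
  \<open>P g\<close>, for \<open>g : W \<rightarrow> V\<close>, expresses that a witness is available at stage \<open>W\<close>.
  The definition forces the existential statement at stage \<open>V\<close>, via the encoding of
  \<open>\<exists>x. \<phi>\<close> as \<open>\<forall>\<omega>. (\<forall>x. \<phi> \<longrightarrow> \<omega>) \<longrightarrow> \<omega>\<close> of intuitionistic higher-order logic, where the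
  truth values \<open>\<omega>\<close> at stage \<open>W\<close> are the subobjects \<open>m\<close> of \<open>W\<close>, and \<open>\<omega>\<close> holds along \<open>h\<close> iff
  \<open>h\<close> factors through \<open>m\<close>.  In a topos this amounts to the availability of a
  witness after passing to an epimorphic cover of \<open>V\<close>.
\<close>

definition locally_exists :: "('o, 'a) cat \<Rightarrow> 'o \<Rightarrow> ('a \<Rightarrow> bool) \<Rightarrow> bool" where
  "locally_exists C V P \<longleftrightarrow>
    (\<forall>g\<in>into C V. \<forall>m. is_mono C m \<and> Cod C m = Dom C g \<longrightarrow>
      (\<forall>h\<in>into C (Dom C g). P (g \<cdot>\<^bsub>C\<^esub> h) \<longrightarrow> factors_through C m h) \<longrightarrow>
      factors_through C m (Ident C (Dom C g)))"


section \<open>Spaces and maps\<close>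

text \<open>
  A space is given by its elements \<open>pts X V\<close> at each stage \<open>V\<close>, with their restriction
  \<open>res X x g\<close> along arrows \<open>g\<close> into \<open>V\<close>.  All spaces considered are objects of the topos, finite
  products of objects, or subspaces of these cut out by a formula.
\<close>

record ('o, 'a, 'x) space =
  pts :: "'o \<Rightarrow> 'x set"
  res :: "'x \<Rightarrow> 'a \<Rightarrow> 'x"

definition object :: "('o, 'a) cat \<Rightarrow> 'o \<Rightarrow> ('o, 'a, 'a) space" where
  "object C X = \<lparr>pts = (\<lambda>V. Hom C V X), res = Comp C\<rparr>"

definition power_space :: "('o, 'a, 'x) space \<Rightarrow> nat \<Rightarrow> ('o, 'a, 'x list) space" where
  "power_space X p =
    \<lparr>pts = (\<lambda>V. {xs. length xs = p \<and> set xs \<subseteq> pts X V}), res = (\<lambda>xs g. map (\<lambda>x. res X x g) xs)\<rparr>"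

definition prod_space ::
    "('o, 'a, 'x) space \<Rightarrow> ('o, 'a, 'y) space \<Rightarrow> ('o, 'a, 'x \<times> 'y) space" where
  "prod_space X Y =
    \<lparr>pts = (\<lambda>V. pts X V \<times> pts Y V), res = (\<lambda>(x, y) g. (res X x g, res Y y g))\<rparr>"

(* S V P: the element P at stage V satisfies the defining formula *)
definition subspace :: "('o, 'a, 'x) space \<Rightarrow> ('o \<Rightarrow> 'x \<Rightarrow> bool) \<Rightarrow> ('o, 'a, 'x) space" where
  "subspace X S = X\<lparr>pts := (\<lambda>V. {x \<in> pts X V. S V x})\<rparr>"

text \<open>
  Maps \<open>X \<rightarrow> Y\<close> at stage \<open>V\<close>, i.e. elements at stage \<open>V\<close> of the function space (equivalently, by
  Yoneda, arrows \<open>V \<times> X \<rightarrow> Y\<close>): \<open>t g x\<close> is the value at an element \<open>x\<close> of \<open>X\<close> at the later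
  stage \<open>g : W \<rightarrow> V\<close>.
\<close>

definition maps ::
    "('o, 'a) cat \<Rightarrow> 'o \<Rightarrow> ('o, 'a, 'x) space \<Rightarrow> ('o, 'a, 'y) space \<Rightarrow> ('a \<Rightarrow> 'x \<Rightarrow> 'y) set" where
  "maps C V X Y = {t. \<forall>g\<in>into C V. \<forall>x\<in>pts X (Dom C g).
      t g x \<in> pts Y (Dom C g) \<and>
      (\<forall>h\<in>into C (Dom C g). t (g \<cdot>\<^bsub>C\<^esub> h) (res X x h) = res Y (t g x) h)}"

text \<open>
  A subspace \<open>U \<hookrightarrow> X\<close> at stage \<open>V\<close>, with \<open>U\<close> itself an arbitrary space at stage \<open>V\<close>: an arrow
  \<open>q : U \<rightarrow> V\<close> (an object of the slice over \<open>V\<close>) and a \<open>U\<close>-element \<open>f\<close> of \<open>X\<close>, jointly injective.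
  The elements of \<open>U\<close> at the later stage \<open>g : W \<rightarrow> V\<close> are the arrows \<open>w : W \<rightarrow> U\<close> over \<open>g\<close>.
\<close>

definition embedding ::
    "('o, 'a) cat \<Rightarrow> ('o, 'a, 'x) space \<Rightarrow> 'o \<Rightarrow> 'a \<Rightarrow> 'x \<Rightarrow> bool" where
  "embedding C X V q f \<longleftrightarrow> q \<in> into C V \<and> f \<in> pts X (Dom C q) \<and>
    (\<forall>W\<in>Ob C. \<forall>u\<in>Hom C W (Dom C q). \<forall>v\<in>Hom C W (Dom C q).
      q \<cdot>\<^bsub>C\<^esub> u = q \<cdot>\<^bsub>C\<^esub> v \<and> res X f u = res X f v \<longrightarrow> u = v)"

definition in_sub ::
    "('o, 'a) cat \<Rightarrow> ('o, 'a, 'x) space \<Rightarrow> 'a \<Rightarrow> 'x \<Rightarrow> 'a \<Rightarrow> 'x \<Rightarrow> bool" where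
  "in_sub C X q f g x \<longleftrightarrow>
    (\<exists>w\<in>Hom C (Dom C g) (Dom C q). q \<cdot>\<^bsub>C\<^esub> w = g \<and> res X f w = x)"


section \<open>The ring and the Kock--Lawvere axiom\<close>

text \<open>
  A commutative ring in the topos, given through Yoneda by the rings \<open>R V\<close> of its elements at
  each stage \<open>V\<close>.
\<close>

definition ring_object :: "('o, 'a) cat \<Rightarrow> ('o \<Rightarrow> 'a ring) \<Rightarrow> bool" where
  "ring_object C R \<longleftrightarrow>
    (\<exists>X\<in>Ob C. \<forall>V\<in>Ob C. carrier (R V) = Hom C V X) \<and>
    (\<forall>V\<in>Ob C. cring (R V)) \<and>
    (\<forall>g\<in>Arr C. (\<lambda>x. x \<cdot>\<^bsub>C\<^esub> g) \<in> ring_hom (R (Cod C g)) (R (Dom C g)))"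

definition rat_ring :: "rat ring" where
  "rat_ring = \<lparr>carrier = UNIV, mult = (*), one = 1, zero = 0, add = (+)\<rparr>"

(* such ring homomorphisms are unique, hence automatically compatible with restriction *)
definition rat_algebra :: "('o, 'a) cat \<Rightarrow> ('o \<Rightarrow> 'a ring) \<Rightarrow> bool" where
  "rat_algebra C R \<longleftrightarrow> (\<forall>V\<in>Ob C. \<exists>h. h \<in> ring_hom rat_ring (R V))"

definition ring_space :: "('o, 'a) cat \<Rightarrow> ('o \<Rightarrow> 'a ring) \<Rightarrow> ('o, 'a, 'a) space" where
  "ring_space C R = \<lparr>pts = (\<lambda>V. carrier (R V)), res = Comp C\<rparr>"

definition Rn :: "('o, 'a) cat \<Rightarrow> ('o \<Rightarrow> 'a ring) \<Rightarrow> nat \<Rightarrow> ('o, 'a, 'a list) space" where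
  "Rn C R n = power_space (ring_space C R) n"

definition vadd :: "'a ring \<Rightarrow> 'a list \<Rightarrow> 'a list \<Rightarrow> 'a list" where
  "vadd S u v = map2 (\<lambda>x y. x \<oplus>\<^bsub>S\<^esub> y) u v"

definition vdiff :: "'a ring \<Rightarrow> 'a list \<Rightarrow> 'a list \<Rightarrow> 'a list" where
  "vdiff S u v = map2 (\<lambda>x y. x \<ominus>\<^bsub>S\<^esub> y) u v"

definition vscale :: "'a ring \<Rightarrow> 'a \<Rightarrow> 'a list \<Rightarrow> 'a list" where
  "vscale S a u = map (\<lambda>x. a \<otimes>\<^bsub>S\<^esub> x) u"

definition Dk ::
    "('o, 'a) cat \<Rightarrow> ('o \<Rightarrow> 'a ring) \<Rightarrow> nat \<Rightarrow> nat \<Rightarrow> ('o, 'a, 'a list) space" where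
  "Dk C R k n = subspace (Rn C R n) (\<lambda>V d.
    \<forall>j :: nat \<Rightarrow> nat. (\<forall>l\<le>k. j l < n) \<longrightarrow> (\<Otimes>\<^bsub>R V\<^esub>l\<in>{..k}. d ! j l) = \<zero>\<^bsub>R V\<^esub>)"

definition exponents :: "nat \<Rightarrow> nat \<Rightarrow> nat list set" where
  "exponents n k = {\<alpha>. length \<alpha> = n \<and> sum_list \<alpha> \<le> k}"

(* value at d of the polynomial in n variables of total degree at most k with coefficients c *)
definition poly_value :: "'a ring \<Rightarrow> nat \<Rightarrow> nat \<Rightarrow> (nat list \<Rightarrow> 'a) \<Rightarrow> 'a list \<Rightarrow> 'a" where
  "poly_value S n k c d =
    (\<Oplus>\<^bsub>S\<^esub>\<alpha>\<in>exponents n k. c \<alpha> \<otimes>\<^bsub>S\<^esub> (\<Otimes>\<^bsub>S\<^esub>i\<in>{..<n}. (d ! i) [^]\<^bsub>S\<^esub> (\<alpha> ! i)))"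

definition kock_lawvere :: "('o, 'a) cat \<Rightarrow> ('o \<Rightarrow> 'a ring) \<Rightarrow> bool" where
  "kock_lawvere C R \<longleftrightarrow>
    (\<forall>k\<ge>1. \<forall>n\<ge>1. \<forall>V\<in>Ob C. \<forall>t\<in>maps C V (Dk C R k n) (ring_space C R).
      \<exists>!c. c \<in> exponents n k \<rightarrow>\<^sub>E carrier (R V) \<and>
        (\<forall>g\<in>into C V. \<forall>d\<in>pts (Dk C R k n) (Dom C g).
          t g d = poly_value (R (Dom C g)) n k (\<lambda>\<alpha>. c \<alpha> \<cdot>\<^bsub>C\<^esub> g) d))"


section \<open>Formal manifolds\<close>

definition formally_open ::
    "('o, 'a) cat \<Rightarrow> ('o \<Rightarrow> 'a ring) \<Rightarrow> ('o, 'a, 'x) space \<Rightarrow> 'o \<Rightarrow> 'a \<Rightarrow> 'x \<Rightarrow> bool" where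
  "formally_open C R X V q f \<longleftrightarrow> embedding C X V q f \<and>
    (\<forall>k\<ge>1. \<forall>m\<ge>1. \<forall>g\<in>into C V. \<forall>t\<in>maps C (Dom C g) (Dk C R k m) X.
      in_sub C X q f g (t (Ident C (Dom C g)) (replicate m \<zero>\<^bsub>R (Dom C g)\<^esub>)) \<longrightarrow>
      (\<forall>h\<in>into C (Dom C g). \<forall>d\<in>pts (Dk C R k m) (Dom C h).
        in_sub C X q f (g \<cdot>\<^bsub>C\<^esub> h) (t h d)))"

(* the domain of q with its embeddings \<iota> into A and \<phi> into R^n, at stage V *)
definition chart ::
    "('o, 'a) cat \<Rightarrow> ('o \<Rightarrow> 'a ring) \<Rightarrow> nat \<Rightarrow> 'o \<Rightarrow> 'o \<Rightarrow> 'a \<Rightarrow> 'a \<Rightarrow> 'a list \<Rightarrow> bool" where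
  "chart C R n A V q \<iota> \<phi> \<longleftrightarrow>
    formally_open C R (object C A) V q \<iota> \<and> formally_open C R (Rn C R n) V q \<phi>"

definition formal_manifold ::
    "('o, 'a) cat \<Rightarrow> ('o \<Rightarrow> 'a ring) \<Rightarrow> nat \<Rightarrow> 'o \<Rightarrow> 'o \<Rightarrow> bool" where
  "formal_manifold C R n A V \<longleftrightarrow> A \<in> Ob C \<and>
    (\<forall>g\<in>into C V. \<forall>P\<in>Hom C (Dom C g) A.
      locally_exists C (Dom C g) (\<lambda>h. \<exists>q \<iota> \<phi>. chart C R n A (Dom C h) q \<iota> \<phi> \<and>
        in_sub C (object C A) q \<iota> (Ident C (Dom C h)) (P \<cdot>\<^bsub>C\<^esub> h)))"


section \<open>Infinitesimal structures of order \<open>k\<close>\<close>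

definition multilinear_maps ::
    "('o, 'a) cat \<Rightarrow> ('o \<Rightarrow> 'a ring) \<Rightarrow> nat \<Rightarrow> nat \<Rightarrow> 'o \<Rightarrow> ('a \<Rightarrow> 'a list list \<Rightarrow> 'a) set" where
  "multilinear_maps C R n r V =
    {\<phi> \<in> maps C V (power_space (Rn C R n) r) (ring_space C R).
      \<forall>g\<in>into C V. \<forall>vs\<in>pts (power_space (Rn C R n) r) (Dom C g). \<forall>l<r.
        (\<forall>u\<in>pts (Rn C R n) (Dom C g). \<forall>v\<in>pts (Rn C R n) (Dom C g).
          \<phi> g (vs[l := vadd (R (Dom C g)) u v]) =
            \<phi> g (vs[l := u]) \<oplus>\<^bsub>R (Dom C g)\<^esub> \<phi> g (vs[l := v])) \<and>
        (\<forall>a\<in>carrier (R (Dom C g)). \<forall>u\<in>pts (Rn C R n) (Dom C g).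
          \<phi> g (vs[l := vscale (R (Dom C g)) a u]) = a \<otimes>\<^bsub>R (Dom C g)\<^esub> \<phi> g (vs[l := u]))}"

definition DN ::
    "('o, 'a) cat \<Rightarrow> ('o \<Rightarrow> 'a ring) \<Rightarrow> nat \<Rightarrow> nat \<Rightarrow> ('o, 'a, 'a list list) space" where
  "DN C R k n = subspace (power_space (Dk C R k n) (k + 1)) (\<lambda>V vs.
    \<forall>g\<in>into C V. \<forall>\<phi>\<in>multilinear_maps C R n (k + 1) (Dom C g).
      \<phi> (Ident C (Dom C g)) (res (power_space (Rn C R n) (k + 1)) vs g) = \<zero>\<^bsub>R (Dom C g)\<^esub>)"

definition Rn_nbhd ::
    "('o, 'a) cat \<Rightarrow> ('o \<Rightarrow> 'a ring) \<Rightarrow> nat \<Rightarrow> nat \<Rightarrow> nat \<Rightarrow> ('o, 'a, 'a list list) space" where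
  "Rn_nbhd C R n k p = subspace (power_space (Rn C R n) p) (\<lambda>V Ps.
    2 \<le> p \<longrightarrow>
    (\<forall>i j :: nat \<Rightarrow> nat. (\<forall>l\<le>k. i l < p \<and> j l < p \<and> i l \<noteq> j l) \<longrightarrow>
      map (\<lambda>l. vdiff (R V) (Ps ! i l) (Ps ! j l)) [0..<k + 1] \<in> pts (DN C R k n) V))"

(* A_k<p>; the arrows in ws are the preimages in the chart domain of the components of the tuple *)
definition nbhd ::
    "('o, 'a) cat \<Rightarrow> ('o \<Rightarrow> 'a ring) \<Rightarrow> nat \<Rightarrow> 'o \<Rightarrow> nat \<Rightarrow> nat \<Rightarrow> ('o, 'a, 'a list) space" where
  "nbhd C R n A k p = subspace (power_space (object C A) p) (\<lambda>V Ps.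
    locally_exists C V (\<lambda>g. \<exists>q \<iota> \<phi>. chart C R n A (Dom C g) q \<iota> \<phi> \<and>
      (\<exists>ws\<in>pts (power_space (object C (Dom C q)) p) (Dom C g).
        (\<forall>w\<in>set ws. q \<cdot>\<^bsub>C\<^esub> w = Ident C (Dom C g)) \<and>
        map (\<lambda>w. \<iota> \<cdot>\<^bsub>C\<^esub> w) ws = res (power_space (object C A) p) Ps g \<and>
        map (\<lambda>w. res (Rn C R n) \<phi> w) ws \<in> pts (Rn_nbhd C R n k p) (Dom C g))))"

definition first_order_neighbours ::
    "('o, 'a) cat \<Rightarrow> ('o \<Rightarrow> 'a ring) \<Rightarrow> nat \<Rightarrow> 'o \<Rightarrow> 'o \<Rightarrow> 'a \<Rightarrow> 'a \<Rightarrow> bool" where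
  "first_order_neighbours C R n A V P Q \<longleftrightarrow> [P, Q] \<in> pts (nbhd C R n A 1 2) V"


section \<open>i-affine structures and affine connections\<close>

(* the space of weights \<A>(p) *)
definition weights ::
    "('o, 'a) cat \<Rightarrow> ('o \<Rightarrow> 'a ring) \<Rightarrow> nat \<Rightarrow> ('o, 'a, 'a list) space" where
  "weights C R p = subspace (Rn C R p) (\<lambda>V a. (\<Oplus>\<^bsub>R V\<^esub>j\<in>{..<p}. a ! j) = \<one>\<^bsub>R V\<^esub>)"

definition unit_vector :: "'a ring \<Rightarrow> nat \<Rightarrow> nat \<Rightarrow> 'a list" where
  "unit_vector S p k = map (\<lambda>j. if j = k then \<one>\<^bsub>S\<^esub> else \<zero>\<^bsub>S\<^esub>) [0..<p]"

(* (\<Sum>k. \<mu>_k a^k_j) for j = 0, ..., p - 1, the lists a^k being the members of ls *)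
definition combine :: "'a ring \<Rightarrow> nat \<Rightarrow> 'a list \<Rightarrow> 'a list list \<Rightarrow> 'a list" where
  "combine S p \<mu> ls =
    map (\<lambda>j. \<Oplus>\<^bsub>S\<^esub>k\<in>{..<length ls}. \<mu> ! k \<otimes>\<^bsub>S\<^esub> (ls ! k) ! j) [0..<p]"

text \<open>
  \<open>op p g (a, Ps)\<close> is the combination of the tuple \<open>Ps\<close> in \<open>Ap p\<close> with weights \<open>a\<close>, at the later
  stage \<open>g\<close>; the operations as a whole live at stage \<open>V\<close>.
\<close>

definition i_affine_structure ::
    "('o, 'a) cat \<Rightarrow> ('o \<Rightarrow> 'a ring) \<Rightarrow> 'o \<Rightarrow> (nat \<Rightarrow> ('o, 'a, 'a list) space) \<Rightarrow> 'o \<Rightarrow>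
      (nat \<Rightarrow> 'a \<Rightarrow> 'a list \<times> 'a list \<Rightarrow> 'a) \<Rightarrow> bool" where
  "i_affine_structure C R A Ap V op \<longleftrightarrow>
    (\<forall>p. op p \<in> maps C V (prod_space (weights C R p) (Ap p)) (object C A)) \<and>
    \<comment> \<open>neighbourhood\<close>
    (\<forall>p m. \<forall>g\<in>into C V. \<forall>ls\<in>pts (power_space (weights C R p) m) (Dom C g).
      \<forall>Ps\<in>pts (Ap p) (Dom C g).
        map (\<lambda>l. op p g (l, Ps)) ls \<in> pts (Ap m) (Dom C g)) \<and>
    \<comment> \<open>associativity\<close>
    (\<forall>p m. \<forall>g\<in>into C V. \<forall>ls\<in>pts (power_space (weights C R p) m) (Dom C g).
      \<forall>Ps\<in>pts (Ap p) (Dom C g). \<forall>\<mu>\<in>pts (weights C R m) (Dom C g).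
        op m g (\<mu>, map (\<lambda>l. op p g (l, Ps)) ls) =
        op p g (combine (R (Dom C g)) p \<mu> ls, Ps)) \<and>
    \<comment> \<open>projection\<close>
    (\<forall>p. \<forall>g\<in>into C V. \<forall>Ps\<in>pts (Ap p) (Dom C g). \<forall>k<p.
        op p g (unit_vector (R (Dom C g)) p k, Ps) = Ps ! k)"

definition connection_domain ::
    "('o, 'a) cat \<Rightarrow> ('o \<Rightarrow> 'a ring) \<Rightarrow> nat \<Rightarrow> 'o \<Rightarrow> ('o, 'a, 'a \<times> 'a \<times> 'a) space" where
  "connection_domain C R n A =
    subspace (prod_space (object C A) (prod_space (object C A) (object C A)))
      (\<lambda>V (P, Q, S). first_order_neighbours C R n A V P Q \<and> first_order_neighbours C R n A V P S)"

definition affine_connection ::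
    "('o, 'a) cat \<Rightarrow> ('o \<Rightarrow> 'a ring) \<Rightarrow> nat \<Rightarrow> 'o \<Rightarrow> 'o \<Rightarrow> ('a \<Rightarrow> 'a \<times> 'a \<times> 'a \<Rightarrow> 'a) \<Rightarrow> bool" where
  "affine_connection C R n A V \<Lambda> \<longleftrightarrow>
    \<Lambda> \<in> maps C V (connection_domain C R n A) (object C A) \<and>
    (\<forall>g\<in>into C V. \<forall>P Q. first_order_neighbours C R n A (Dom C g) P Q \<longrightarrow> \<Lambda> g (P, Q, P) = Q) \<and>
    (\<forall>g\<in>into C V. \<forall>P S. first_order_neighbours C R n A (Dom C g) P S \<longrightarrow> \<Lambda> g (P, P, S) = S)"

definition symmetric_connection ::
    "('o, 'a) cat \<Rightarrow> ('o \<Rightarrow> 'a ring) \<Rightarrow> nat \<Rightarrow> 'o \<Rightarrow> 'o \<Rightarrow> ('a \<Rightarrow> 'a \<times> 'a \<times> 'a \<Rightarrow> 'a) \<Rightarrow> bool" where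
  "symmetric_connection C R n A V \<Lambda> \<longleftrightarrow>
    (\<forall>g\<in>into C V. \<forall>P Q S. (P, Q, S) \<in> pts (connection_domain C R n A) (Dom C g) \<longrightarrow>
      \<Lambda> g (P, Q, S) = \<Lambda> g (P, S, Q))"

end

theory Submission
  imports Defs
begin

text \<open>
  The connection completes the infinitesimal parallelogram spanned by \<open>P\<close>, \<open>Q\<close>, \<open>S\<close>: it is
  \<open>\<lambda>(P, Q, S) = Q + S - P\<close>, the affine combination with weights \<open>(-1, 1, 1)\<close>.  The equations
  \<open>Q + P - P = Q\<close>, \<open>P + S - P = S\<close> and \<open>Q + S - P = S + Q - P\<close> follow formally from associativity and
  projection (\<open>i_affine_reindex\<close>).  The mathematical content is that the combination is defined, that
  is, that \<open>(P, Q, S)\<close> belongs to \<open>A\<^sub>2\<langle>3\<rangle>\<close> whenever \<open>Q\<close> and \<open>S\<close> are first-order neighbours of \<open>P\<close>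
  (\<open>nbhd_triple\<close>).

  In a single chart this is a computation (\<open>Rn_nbhd_triple\<close>).  With \<open>d = Q - P\<close> and \<open>e = S - P\<close>, all
  differences of the three points are combinations of \<open>d\<close> and \<open>e\<close>, and any product of three coordinates
  of such vectors contains two coordinates of \<open>d\<close> or two coordinates of \<open>e\<close>, so it is 0.  Expansion in
  the standard basis then kills every trilinear map on these differences (\<open>multilinear_vanishes\<close>).

  In general the neighbours \<open>P, Q\<close> and the neighbours \<open>P, S\<close> are given in different charts.  As \<open>Q\<close> is the
  value at \<open>d\<close> of a map from \<open>D\<^sub>1(n)\<close> to \<open>A\<close> that takes 0 to \<open>P\<close>, formal openness of the second chart puts
  \<open>Q\<close> into it, and the Kock--Lawvere axiom shows that the difference of \<open>Q\<close> and \<open>P\<close> is of first order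
  there too (\<open>chart_transfer\<close>).

  The charts only exist locally in the sense of the internal logic.  Two such existence statements are
  combined by \<open>locally_exists_bind\<close>.
\<close>

section \<open>Internal existence\<close>

lemma into_iff_Hom: "g \<in> into C V \<longleftrightarrow> g \<in> Hom C (Dom C g) V"
  by (auto simp: into_def Hom_def)

lemma Hom_into: "g \<in> Hom C W V \<Longrightarrow> g \<in> into C V"
  by (auto simp: into_def Hom_def)

lemma Hom_Dom: "g \<in> Hom C W V \<Longrightarrow> Dom C g = W"
  by (auto simp: Hom_def)

lemma locally_existsD:
  assumes "locally_exists C V P" "g \<in> into C V" "is_mono C m" "Cod C m = Dom C g"
    and "\<And>h. h \<in> into C (Dom C g) \<Longrightarrow> P (g \<cdot>\<^bsub>C\<^esub> h) \<Longrightarrow> factors_through C m h"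
  shows "factors_through C m (Ident C (Dom C g))"
  using assms unfolding locally_exists_def by blast

context category
begin

lemma Hom_Ob: "g \<in> Hom C W V \<Longrightarrow> W \<in> Ob C" "g \<in> Hom C W V \<Longrightarrow> V \<in> Ob C"
  using Dom_Ob Cod_Ob by (auto simp: Hom_def)

lemma into_Ob: "g \<in> into C V \<Longrightarrow> Dom C g \<in> Ob C" "g \<in> into C V \<Longrightarrow> V \<in> Ob C"
  using Dom_Ob Cod_Ob by (auto simp: into_def)

lemma Comp_into:
  assumes "g \<in> into C V" "h \<in> into C (Dom C g)"
  shows "g \<cdot> h \<in> into C V" and "Dom C (g \<cdot> h) = Dom C h"
proof -
  have "g \<cdot> h \<in> Hom C (Dom C h) V" using assms by (auto simp: into_iff_Hom intro: Comp_Hom)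
  then show "g \<cdot> h \<in> into C V" and "Dom C (g \<cdot> h) = Dom C h"
    by (rule Hom_into, rule Hom_Dom)
qed

lemma Ident_into:
  assumes "V \<in> Ob C"
  shows "Ident C V \<in> into C V" and "Dom C (Ident C V) = V"
  using Ident_Hom[OF assms] by (auto intro: Hom_into Hom_Dom)

lemma locally_exists_restrict:
  assumes P: "locally_exists C V P" and h: "h \<in> into C V"
  shows "locally_exists C (Dom C h) (\<lambda>k. P (h \<cdot> k))"
  unfolding locally_exists_def
proof (intro ballI allI impI)
  fix g m
  assume g: "g \<in> into C (Dom C h)" and m: "is_mono C m \<and> Cod C m = Dom C g"
    and H: "\<forall>k\<in>into C (Dom C g). P (h \<cdot> (g \<cdot> k)) \<longrightarrow> factors_through C m k"
  have "\<forall>k\<in>into C (Dom C g). P (h \<cdot> g \<cdot> k) \<longrightarrow> factors_through C m k"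
  proof (intro ballI impI)
    fix k assume k: "k \<in> into C (Dom C g)" and Pk: "P (h \<cdot> g \<cdot> k)"
    have "h \<cdot> g \<cdot> k = h \<cdot> (g \<cdot> k)"
      using h g k Comp_assoc unfolding into_iff_Hom by blast
    then show "factors_through C m k" using H k Pk by simp
  qed
  moreover have "h \<cdot> g \<in> into C V" "Dom C (h \<cdot> g) = Dom C g" using Comp_into[OF h g] .
  ultimately show "factors_through C m (Ident C (Dom C g))"
    using locally_existsD[OF P, of "h \<cdot> g" m] m by simp
qed

lemma locally_exists_mono:
  assumes P: "locally_exists C V P" and "\<And>h. h \<in> into C V \<Longrightarrow> P h \<Longrightarrow> Q h"
  shows "locally_exists C V Q"
  unfolding locally_exists_def
proof (intro ballI allI impI)
  fix g m
  assume g: "g \<in> into C V" and m: "is_mono C m \<and> Cod C m = Dom C g"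
    and H: "\<forall>h\<in>into C (Dom C g). Q (g \<cdot> h) \<longrightarrow> factors_through C m h"
  show "factors_through C m (Ident C (Dom C g))"
    using assms(2) Comp_into(1)[OF g] H m by (intro locally_existsD[OF P g]) auto
qed

end

text \<open>
  A witness for \<open>P\<close> may be used in the construction of a witness for \<open>Q\<close>, although it is only
  available at a later stage \<open>h\<close>.  The truth value \<open>m\<close> to be proved has to be pulled back to that
  stage; this is where the topos has to have pullbacks.
\<close>

lemma (in elementary_topos) locally_exists_bind:
  assumes P: "locally_exists C V P"
    and step: "\<And>h. h \<in> into C V \<Longrightarrow> P h \<Longrightarrow> locally_exists C (Dom C h) (\<lambda>k. Q (h \<cdot> k))"
  shows "locally_exists C V Q"
  unfolding locally_exists_def
proof (intro ballI allI impI)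
  fix g m
  assume g: "g \<in> into C V" and m: "is_mono C m \<and> Cod C m = Dom C g"
    and H: "\<forall>h\<in>into C (Dom C g). Q (g \<cdot> h) \<longrightarrow> factors_through C m h"
  have "factors_through C m h" if h: "h \<in> into C (Dom C g)" and Ph: "P (g \<cdot> h)" for h
  proof -
    have hHom: "h \<in> Hom C (Dom C h) (Dom C g)" and gHom: "g \<in> Hom C (Dom C g) V"
      and mHom: "m \<in> Hom C (Dom C m) (Dom C g)"
      using h g m by (auto simp: into_def Hom_def is_mono_def)
    \<comment> \<open>\<open>p\<close> is the truth value at which \<open>h\<close> factors through \<open>m\<close>; it will be shown to be true.\<close>
    obtain p r where pb: "is_pullback C h m p r"
      using has_pullbacks[of h m] h m by (auto simp: into_def is_mono_def)
    let ?E = "Dom C p"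
    have p: "p \<in> Hom C ?E (Dom C h)" and r: "r \<in> Hom C ?E (Dom C m)" and sq: "h \<cdot> p = m \<cdot> r"
      using pb by (auto simp: is_pullback_def)
    have univ: "\<exists>!u. u \<in> Hom C T ?E \<and> p \<cdot> u = a \<and> r \<cdot> u = b"
      if "a \<in> Hom C T (Dom C h)" "b \<in> Hom C T (Dom C m)" "h \<cdot> a = m \<cdot> b" for T a b
      using pb that Hom_Ob unfolding is_pullback_def by blast
    have "is_mono C p"
      unfolding is_mono_def
    proof (intro conjI ballI impI)
      show "p \<in> Arr C" using p by (simp add: Hom_def)
      fix T u v
      assume u: "u \<in> Hom C T ?E" and v: "v \<in> Hom C T ?E" and eq: "p \<cdot> u = p \<cdot> v"
      have "m \<cdot> (r \<cdot> u) = m \<cdot> (r \<cdot> v)"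
        using sq eq Comp_assoc[OF hHom p u] Comp_assoc[OF hHom p v]
          Comp_assoc[OF mHom r u] Comp_assoc[OF mHom r v] by simp
      then have "r \<cdot> u = r \<cdot> v"
        using m Comp_Hom[OF r u] Comp_Hom[OF r v] Hom_Ob(1)[OF u] unfolding is_mono_def by blast
      moreover have "h \<cdot> (p \<cdot> u) = m \<cdot> (r \<cdot> u)"
        using sq Comp_assoc[OF hHom p u] Comp_assoc[OF mHom r u] by simp
      ultimately show "u = v"
        using univ[OF Comp_Hom[OF p u] Comp_Hom[OF r u]] u v eq by metis
    qed
    moreover have "factors_through C p k"
      if k: "k \<in> into C (Dom C h)" and Q: "Q (g \<cdot> h \<cdot> (Ident C (Dom C h) \<cdot> k))" for k
    proof -
      have kHom: "k \<in> Hom C (Dom C k) (Dom C h)" using k by (simp add: into_iff_Hom)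
      have "Q (g \<cdot> (h \<cdot> k))"
        using Q Ident_left[OF kHom] Comp_assoc[OF gHom hHom kHom] by simp
      then obtain u where u: "u \<in> Hom C (Dom C k) (Dom C m)" "m \<cdot> u = h \<cdot> k"
        using bspec[OF H Comp_into(1)[OF h k]] Comp_into(2)[OF h k]
        unfolding factors_through_def by auto
      then show ?thesis
        using univ[OF kHom u(1)] unfolding factors_through_def by auto
    qed
    moreover have "locally_exists C (Dom C h) (\<lambda>k. Q (g \<cdot> h \<cdot> k))"
      using step[OF Comp_into(1)[OF g h] Ph] Comp_into(2)[OF g h] by simp
    moreover have "Cod C p = Dom C h" using p by (simp add: Hom_def)
    ultimately have "factors_through C p (Ident C (Dom C h))"
      using locally_existsD[of C "Dom C h" "\<lambda>k. Q (g \<cdot> h \<cdot> k)" "Ident C (Dom C h)" p]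
        Ident_into[OF into_Ob(1)[OF h]] by simp
    then obtain u where u: "u \<in> Hom C (Dom C h) ?E" "p \<cdot> u = Ident C (Dom C h)"
      using Ident_into[OF into_Ob(1)[OF h]] unfolding factors_through_def by auto
    have "m \<cdot> (r \<cdot> u) = h"
      using Comp_assoc[OF hHom p u(1)] Comp_assoc[OF mHom r u(1)] sq u(2) Ident_right[OF hHom]
      by simp
    then show ?thesis using Comp_Hom[OF r u(1)] unfolding factors_through_def by blast
  qed
  then show "factors_through C m (Ident C (Dom C g))"
    using locally_existsD[OF P g] m by blast
qed

section \<open>Linear algebra over a commutative ring\<close>

text \<open>
  The type \<^typ>\<open>'a ring\<close>, without record extensions, is the one on which vectors and polynomials
  are defined.
\<close>

locale plain_cring = cring R for R :: "'a ring" (structure)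

definition vectors :: "'a ring \<Rightarrow> nat \<Rightarrow> 'a list set" where
  "vectors S n = {v. length v = n \<and> set v \<subseteq> carrier S}"

lemma vectors_iff: "v \<in> vectors S n \<longleftrightarrow> length v = n \<and> (\<forall>i<n. v ! i \<in> carrier S)"
  by (auto simp: vectors_def set_conv_nth)

text \<open>
  A linear map is determined by its values on the standard basis, so its value at \<open>v\<close> lies in the
  ideal generated by the products \<open>v\<^sub>i f(e\<^sub>i)\<close>.  The scalar \<open>c\<close> lets the lemma be iterated over the
  arguments of a multilinear map.
\<close>

lemma (in plain_cring) linear_vanishes:
  assumes f: "\<And>u. u \<in> vectors R n \<Longrightarrow> f u \<in> carrier R"
    and add: "\<And>u v. u \<in> vectors R n \<Longrightarrow> v \<in> vectors R n \<Longrightarrow> f (vadd R u v) = f u \<oplus> f v"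
    and scale: "\<And>a u. a \<in> carrier R \<Longrightarrow> u \<in> vectors R n \<Longrightarrow> f (vscale R a u) = a \<otimes> f u"
    and v: "v \<in> vectors R n" and c: "c \<in> carrier R"
    and ann: "\<And>i. i < n \<Longrightarrow> c \<otimes> (v ! i) \<otimes> f (unit_vector R n i) = \<zero>"
  shows "c \<otimes> f v = \<zero>"
proof -
  define p where "p m = map (\<lambda>i. if i < m then v ! i else \<zero>) [0..<n]" for m
  have p: "p m \<in> vectors R n" for m
    using v by (auto simp: vectors_iff p_def)
  have e: "unit_vector R n i \<in> vectors R n" for i
    by (auto simp: vectors_iff unit_vector_def)
  have "c \<otimes> f (p m) = \<zero>" if "m \<le> n" for m
    using that
  proof (induction m)
    case 0
    have "p 0 = vscale R \<zero> v"
      using v by (intro nth_equalityI) (auto simp: vectors_iff p_def vscale_def)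
    then show ?case using scale[of \<zero> v] v c f by simp
  next
    case (Suc m)
    then have vm: "v ! m \<in> carrier R" using v by (simp add: vectors_iff)
    have s: "vscale R (v ! m) (unit_vector R n m) \<in> vectors R n"
      using vm by (auto simp: vectors_iff unit_vector_def vscale_def)
    have "p (Suc m) = vadd R (p m) (vscale R (v ! m) (unit_vector R n m))"
      using v vm by (intro nth_equalityI)
        (auto simp: vectors_iff p_def vscale_def vadd_def unit_vector_def less_Suc_eq)
    then have "c \<otimes> f (p (Suc m)) = c \<otimes> f (p m) \<oplus> c \<otimes> (v ! m) \<otimes> f (unit_vector R n m)"
      using add[OF p s] scale[OF vm e] c vm f[OF p] f[OF e] by (simp add: r_distr m_assoc)
    then show ?case using Suc ann[of m] by simp
  qed
  moreover have "p n = v"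
    using v by (intro nth_equalityI) (auto simp: vectors_iff p_def)
  ultimately show ?thesis by (metis order_refl)
qed

text \<open>
  The expansion of \<open>f (v\<^sub>0, \<dots>, v\<^sub>r\<^sub>-\<^sub>1)\<close> in the standard basis has the products of coordinates in
  \<open>ann\<close> as coefficients.  The expansion itself is avoided: the vectors replace the basis vectors one
  argument at a time, with the product of the remaining coordinates as the scalar \<open>c\<close> of
  \<open>linear_vanishes\<close>.
\<close>

lemma (in plain_cring) multilinear_vanishes:
  assumes f: "\<And>vs. length vs = r \<Longrightarrow> set vs \<subseteq> vectors R n \<Longrightarrow> f vs \<in> carrier R"
    and add: "\<And>vs l u v. length vs = r \<Longrightarrow> set vs \<subseteq> vectors R n \<Longrightarrow> l < r \<Longrightarrow>
      u \<in> vectors R n \<Longrightarrow> v \<in> vectors R n \<Longrightarrow>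
      f (vs[l := vadd R u v]) = f (vs[l := u]) \<oplus> f (vs[l := v])"
    and scale: "\<And>vs l a u. length vs = r \<Longrightarrow> set vs \<subseteq> vectors R n \<Longrightarrow> l < r \<Longrightarrow>
      a \<in> carrier R \<Longrightarrow> u \<in> vectors R n \<Longrightarrow> f (vs[l := vscale R a u]) = a \<otimes> f (vs[l := u])"
    and vs: "length vs = r" "set vs \<subseteq> vectors R n"
    and ann: "\<And>i. (\<And>l. l < r \<Longrightarrow> i l < n) \<Longrightarrow> (\<Otimes>l\<in>{..<r}. vs ! l ! i l) = \<zero>"
  shows "f vs = \<zero>"
proof -
  define mixed where
    "mixed m i = map (\<lambda>l. if l < m then vs ! l else unit_vector R n (i l)) [0..<r]" for m i
  have e: "unit_vector R n i \<in> vectors R n" for i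
    by (auto simp: vectors_iff unit_vector_def)
  have vsl: "vs ! l \<in> vectors R n" if "l < r" for l
    using vs that by (metis nth_mem subsetD)
  have mixed: "length (mixed m i) = r" "set (mixed m i) \<subseteq> vectors R n" for m i
    using e vsl by (auto simp: mixed_def)
  have coord: "vs ! l ! i l \<in> carrier R" if "l < r" "\<And>l. l < r \<Longrightarrow> i l < n" for l i
    using vsl[OF that(1)] that by (simp add: vectors_iff)
  have "(\<Otimes>l\<in>{m..<r}. vs ! l ! i l) \<otimes> f (mixed m i) = \<zero>"
    if "m \<le> r" and i: "\<And>l. l < r \<Longrightarrow> i l < n" for m i
    using that
  proof (induction m arbitrary: i)
    case 0
    then show ?case using ann[of i] f[OF mixed] by (simp add: atLeast0LessThan)
  next
    case (Suc m)
    then have m: "m < r" by simp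
    let ?c = "\<Otimes>l\<in>{Suc m..<r}. vs ! l ! i l"
    let ?f = "\<lambda>u. f ((mixed m i)[m := u])"
    have c: "?c \<in> carrier R"
      using coord[OF _ Suc.prems(2)] by (intro finprod_closed) auto
    have "?c \<otimes> ?f (vs ! m) = \<zero>"
    proof (rule linear_vanishes[where f = ?f and n = n])
      fix u assume "u \<in> vectors R n"
      then show "?f u \<in> carrier R"
        using mixed[of m i] by (intro f) (auto dest: subsetD[OF set_update_subset_insert])
    next
      fix u v assume "u \<in> vectors R n" "v \<in> vectors R n"
      then show "?f (vadd R u v) = ?f u \<oplus> ?f v" using add mixed m by metis
    next
      fix a u assume "a \<in> carrier R" "u \<in> vectors R n"
      then show "?f (vscale R a u) = a \<otimes> ?f u" using scale mixed m by metis
    next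
      show "vs ! m \<in> vectors R n" by (rule vsl[OF m])
    next
      show "?c \<in> carrier R" by (rule c)
    next
      fix j assume j: "j < n"
      let ?i = "i(m := j)"
      have i': "\<And>l. l < r \<Longrightarrow> ?i l < n" using Suc.prems(2) j by simp
      have ci: "vs ! l ! ?i l \<in> carrier R" if "l < r" for l
        using coord[of l ?i, OF that] i' by blast
      have eq: "(mixed m i)[m := unit_vector R n j] = mixed m ?i"
        by (intro nth_equalityI) (auto simp: mixed_def nth_list_update)
      have split: "{m..<r} = insert m {Suc m..<r}" using m by auto
      have c': "?c = (\<Otimes>l\<in>{Suc m..<r}. vs ! l ! ?i l)"
      proof (rule finprod_cong')
        show "(\<lambda>l. vs ! l ! ?i l) \<in> {Suc m..<r} \<rightarrow> carrier R"
          using ci by (intro Pi_I) (metis atLeastLessThan_iff)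
      qed auto
      have "(\<Otimes>l\<in>{m..<r}. vs ! l ! ?i l) = vs ! m ! j \<otimes> ?c"
        unfolding c' split by (subst finprod_insert) (use ci ci[OF m] m in \<open>auto simp del: fun_upd_apply simp: fun_upd_same\<close>)
      also have "\<dots> = ?c \<otimes> (vs ! m ! j)"
        using c ci[OF m] by (simp add: m_comm)
      finally show "?c \<otimes> (vs ! m ! j) \<otimes> ?f (unit_vector R n j) = \<zero>"
        using Suc.IH[of ?i, OF _ i'] m by (simp del: fun_upd_apply add: eq)
    qed
    moreover have "(mixed m i)[m := vs ! m] = mixed (Suc m) i"
      by (rule nth_equalityI) (auto simp: mixed_def nth_list_update less_Suc_eq)
    ultimately show ?case by simp
  qed
  \<comment> \<open>The induction needs a choice of indices below \<open>n\<close>; in dimension 0 every vector is zero.\<close>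
  from this[of r "\<lambda>_. 0"] ann[of "\<lambda>_. 0"] consider "n = 0 \<and> r > 0" | "f (mixed r (\<lambda>_. 0)) = \<zero>"
    using f[OF mixed] by fastforce
  then show ?thesis
  proof cases
    case 1
    then have "vs = (vs[0 := vscale R \<zero> (vs ! 0)])"
      using vsl[of 0] list_update_id[of vs 0] by (auto simp: vectors_iff vscale_def)
    then show ?thesis using scale[of vs 0 \<zero> "vs ! 0"] vs vsl[of 0] 1 f[of "vs"]
      by (metis list_update_id l_null zero_closed)
  next
    case 2
    moreover have "mixed r (\<lambda>_. 0) = vs"
      using vs by (intro nth_equalityI) (auto simp: mixed_def)
    ultimately show ?thesis by simp
  qed
qed

lemma finite_exponents: "finite (exponents n k)"
proof (rule finite_subset)
  show "exponents n k \<subseteq> {xs. set xs \<subseteq> {..k} \<and> length xs = n}"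
    by (auto simp: exponents_def intro: order_trans[OF member_le_sum_list])
qed (simp add: finite_lists_length_eq)

text \<open>
  A polynomial function differs from its constant term by an element of the ideal generated by the
  arguments, so whatever annihilates the arguments annihilates this difference.
\<close>

lemma (in plain_cring) annihilator_poly_value:
  assumes c: "c \<in> carrier R" and a: "a \<in> exponents n k \<rightarrow> carrier R" and d: "d \<in> vectors R n"
    and ann: "\<And>i. i < n \<Longrightarrow> c \<otimes> (d ! i) = \<zero>"
  shows "c \<otimes> poly_value R n k a d = c \<otimes> poly_value R n k a (replicate n \<zero>)"
proof -
  have di: "d ! i \<in> carrier R" if "i < n" for i using d that by (simp add: vectors_iff)
  let ?m = "\<lambda>(v :: 'a list) \<alpha> (i :: nat). (v ! i) [^] (\<alpha> ! i :: nat)"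
  have factor: "c \<otimes> ?m d \<alpha> i = c \<otimes> ?m (replicate n \<zero>) \<alpha> i" if i: "i < n" for \<alpha> i
  proof (cases "\<alpha> ! i")
    case (Suc j)
    have "c \<otimes> (d ! i) [^] Suc j = (c \<otimes> (d ! i)) \<otimes> (d ! i) [^] j"
      using c di[OF i] by (simp add: m_ac)
    then show ?thesis using Suc ann[OF i] c di[OF i] i by simp
  qed (use i in simp)
  have monom: "c \<otimes> (\<Otimes>i\<in>I. ?m d \<alpha> i) = c \<otimes> (\<Otimes>i\<in>I. ?m (replicate n \<zero>) \<alpha> i)"
    if "finite I" "I \<subseteq> {..<n}" for I \<alpha>
    using that
  proof (induction I)
    case (insert j I)
    then have j: "j < n" by simp
    let ?P = "\<lambda>v. \<Otimes>i\<in>I. ?m v \<alpha> i"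
    have P: "?P d \<in> carrier R" "?P (replicate n \<zero>) \<in> carrier R"
      using insert.prems di by (auto intro!: finprod_closed)
    have x: "?m d \<alpha> j \<in> carrier R" "?m (replicate n \<zero>) \<alpha> j \<in> carrier R"
      using di[OF j] j by auto
    have ins: "(\<Otimes>i\<in>insert j I. ?m v \<alpha> i) = ?m v \<alpha> j \<otimes> ?P v"
      if "v \<in> vectors R n" for v
      using insert that by (intro finprod_insert) (auto simp: vectors_iff)
    have r: "replicate n \<zero> \<in> vectors R n" by (simp add: vectors_iff)
    have "c \<otimes> (?m d \<alpha> j \<otimes> ?P d) = (c \<otimes> ?m d \<alpha> j) \<otimes> ?P d"
      using c x P by (simp add: m_assoc)
    also have "\<dots> = ?m (replicate n \<zero>) \<alpha> j \<otimes> (c \<otimes> ?P d)"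
      unfolding factor[OF j] using c x P by (simp add: m_ac)
    also have "\<dots> = c \<otimes> (?m (replicate n \<zero>) \<alpha> j \<otimes> ?P (replicate n \<zero>))"
      using c x P insert by (simp add: m_lcomm)
    finally show ?case by (simp only: ins[OF d] ins[OF r])
  qed simp
  have closed: "(\<Otimes>i\<in>{..<n}. ?m v \<alpha> i) \<in> carrier R" if "v \<in> vectors R n" for v \<alpha>
    using that by (auto simp: vectors_iff intro!: finprod_closed)
  have r: "replicate n \<zero> \<in> vectors R n" by (simp add: vectors_iff)
  have a': "a \<alpha> \<in> carrier R" if "\<alpha> \<in> exponents n k" for \<alpha> using a that by auto
  have dist: "c \<otimes> poly_value R n k a v =
    (\<Oplus>\<alpha>\<in>exponents n k. a \<alpha> \<otimes> (c \<otimes> (\<Otimes>i\<in>{..<n}. ?m v \<alpha> i)))" if v: "v \<in> vectors R n" for v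
    unfolding poly_value_def using closed[OF v] a' c finite_exponents
    by (subst finsum_rdistr) (auto intro!: finsum_cong' simp: m_lcomm)
  show "c \<otimes> poly_value R n k a d = c \<otimes> poly_value R n k a (replicate n \<zero>)"
    unfolding dist[OF d] dist[OF r] by (simp add: monom)
qed

text \<open>
  Among three factors that each come from \<open>N\<^sub>1\<close> or \<open>N\<^sub>2\<close>, two come from the same set.
\<close>

lemma (in plain_cring) prod_of_split_vanishes:
  assumes x: "x1 \<in> N1" "x2 \<in> N2" and y: "y1 \<in> N1" "y2 \<in> N2" and z: "z1 \<in> N1" "z2 \<in> N2"
    and N: "N1 \<subseteq> carrier R" "N2 \<subseteq> carrier R"
    and ann: "\<And>u v. u \<in> N1 \<Longrightarrow> v \<in> N1 \<Longrightarrow> u \<otimes> v = \<zero>"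
      "\<And>u v. u \<in> N2 \<Longrightarrow> v \<in> N2 \<Longrightarrow> u \<otimes> v = \<zero>"
  shows "(x1 \<oplus> x2) \<otimes> (y1 \<oplus> y2) \<otimes> (z1 \<oplus> z2) = \<zero>"
proof -
  have c: "x1 \<in> carrier R" "x2 \<in> carrier R" "y1 \<in> carrier R" "y2 \<in> carrier R"
    "z1 \<in> carrier R" "z2 \<in> carrier R" using assms by auto
  have xy: "(x1 \<oplus> x2) \<otimes> (y1 \<oplus> y2) = x1 \<otimes> y2 \<oplus> x2 \<otimes> y1"
    using c ann(1)[OF x(1) y(1)] ann(2)[OF x(2) y(2)] by (simp add: l_distr r_distr a_comm)
  have 1: "x1 \<otimes> y2 \<otimes> z1 = y2 \<otimes> (x1 \<otimes> z1)" "x2 \<otimes> y1 \<otimes> z2 = y1 \<otimes> (x2 \<otimes> z2)"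
    "x1 \<otimes> y2 \<otimes> z2 = x1 \<otimes> (y2 \<otimes> z2)" "x2 \<otimes> y1 \<otimes> z1 = x2 \<otimes> (y1 \<otimes> z1)"
    using c by (simp_all add: m_ac)
  show ?thesis
    using c ann(1)[OF x(1) z(1)] ann(2)[OF x(2) z(2)] ann(2)[OF y(2) z(2)] ann(1)[OF y(1) z(1)]
    by (simp add: xy l_distr r_distr 1)
qed

lemma (in plain_cring) unit_vector_weights:
  assumes "k < p"
  shows "unit_vector R p k \<in> vectors R p" and "(\<Oplus>j\<in>{..<p}. unit_vector R p k ! j) = \<one>"
proof -
  show "unit_vector R p k \<in> vectors R p" by (auto simp: vectors_iff unit_vector_def)
  have "(\<Oplus>j\<in>{..<p}. unit_vector R p k ! j) = (\<Oplus>j\<in>{..<p}. if k = j then \<one> else \<zero>)"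
    by (intro finsum_cong') (auto simp: unit_vector_def)
  also have "\<dots> = \<one>" using add.finprod_singleton[of k "{..<p}" "\<lambda>_. \<one>"] assms by simp
  finally show "(\<Oplus>j\<in>{..<p}. unit_vector R p k ! j) = \<one>" .
qed

lemma (in plain_cring) finsum_three:
  assumes "f 0 \<in> carrier R" "f 1 \<in> carrier R" "f (2::nat) \<in> carrier R"
  shows "(\<Oplus>k\<in>{..<3}. f k) = f 0 \<oplus> f 1 \<oplus> f 2"
proof -
  have s: "{..<3::nat} = insert 2 (insert 1 {0})" by auto
  show ?thesis unfolding s using assms by (simp add: finsum_insert a_ac)
qed

lemma (in plain_cring) finprod_three:
  assumes "f 0 \<in> carrier R" "f 1 \<in> carrier R" "f (2::nat) \<in> carrier R"
  shows "(\<Otimes>k\<in>{..2}. f k) = f 0 \<otimes> f 1 \<otimes> f 2"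
proof -
  have s: "{..2::nat} = insert 2 (insert 1 {0})" by auto
  show ?thesis unfolding s using assms by (simp add: m_ac)
qed

lemma (in plain_cring) finprod_two:
  assumes "f 0 \<in> carrier R" "f (1::nat) \<in> carrier R"
  shows "(\<Otimes>k\<in>{..1}. f k) = f 0 \<otimes> f 1"
proof -
  have s: "{..1::nat} = insert 1 {0}" by auto
  show ?thesis unfolding s using assms by (simp add: m_ac)
qed

lemma length_vadd_vdiff [simp]:
  "length (vadd S u v) = min (length u) (length v)" "length (vdiff S u v) = min (length u) (length v)"
  by (simp_all add: vadd_def vdiff_def)

lemma nth_vadd: "i < length u \<Longrightarrow> i < length v \<Longrightarrow> vadd S u v ! i = u ! i \<oplus>\<^bsub>S\<^esub> v ! i"
  and nth_vdiff: "i < length u \<Longrightarrow> i < length v \<Longrightarrow> vdiff S u v ! i = u ! i \<ominus>\<^bsub>S\<^esub> v ! i"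
  by (simp_all add: vadd_def vdiff_def)

lemma (in plain_cring) vadd_closed:
  "u \<in> vectors R n \<Longrightarrow> v \<in> vectors R n \<Longrightarrow> vadd R u v \<in> vectors R n"
  by (auto simp: vectors_iff nth_vadd)

lemma (in plain_cring) vdiff_closed:
  "u \<in> vectors R n \<Longrightarrow> v \<in> vectors R n \<Longrightarrow> vdiff R u v \<in> vectors R n"
  by (auto simp: vectors_iff nth_vdiff)

lemma (in plain_cring) vadd_zero:
  "u \<in> vectors R n \<Longrightarrow> vadd R u (replicate n \<zero>) = u"
  by (rule nth_equalityI) (auto simp: vectors_iff nth_vadd)

lemma (in plain_cring) vadd_vdiff:
  assumes "u \<in> vectors R n" "v \<in> vectors R n"
  shows "vadd R u (vdiff R v u) = v"
proof (rule nth_equalityI)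
  fix i assume "i < length (vadd R u (vdiff R v u))"
  then have i: "i < n" using assms by (simp add: vectors_iff)
  then have c: "u ! i \<in> carrier R" "v ! i \<in> carrier R" using assms by (simp_all add: vectors_iff)
  have "u ! i \<oplus> (v ! i \<ominus> u ! i) = v ! i" using c a_lcomm[of "u ! i" "v ! i" "\<ominus> u ! i"] by (simp add: minus_eq r_neg)
  then show "vadd R u (vdiff R v u) ! i = v ! i"
    using i assms by (simp add: vectors_iff nth_vadd nth_vdiff)
qed (use assms in \<open>simp add: vectors_iff\<close>)

section \<open>Restriction along later stages\<close>

definition presheaf :: "('o, 'a) cat \<Rightarrow> ('o, 'a, 'x) space \<Rightarrow> bool" where
  "presheaf C X \<longleftrightarrow>
    (\<forall>V. \<forall>x\<in>pts X V. \<forall>g\<in>into C V. res X x g \<in> pts X (Dom C g) \<and>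
      (\<forall>h\<in>into C (Dom C g). res X x (g \<cdot>\<^bsub>C\<^esub> h) = res X (res X x g) h))"

lemma presheafD:
  assumes "presheaf C X" "x \<in> pts X V" "g \<in> into C V"
  shows "res X x g \<in> pts X (Dom C g)"
    and "h \<in> into C (Dom C g) \<Longrightarrow> res X x (g \<cdot>\<^bsub>C\<^esub> h) = res X (res X x g) h"
  using assms by (auto simp: presheaf_def)

lemma (in category) presheaf_object: "presheaf C (object C X)"
  unfolding presheaf_def object_def
  using Comp_Hom Comp_assoc by (auto simp: into_iff_Hom)

lemma presheaf_power_space: "presheaf C X \<Longrightarrow> presheaf C (power_space X p)"
  unfolding presheaf_def power_space_def by fastforce

lemma embedding_unique:
  assumes "embedding C X V q f" "u \<in> Hom C W (Dom C q)" "v \<in> Hom C W (Dom C q)" "W \<in> Ob C"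
    and "q \<cdot>\<^bsub>C\<^esub> u = q \<cdot>\<^bsub>C\<^esub> v" "res X f u = res X f v"
  shows "u = v"
  using assms by (auto simp: embedding_def)

lemma maps_closed:
  "t \<in> maps C V X Y \<Longrightarrow> g \<in> into C V \<Longrightarrow> x \<in> pts X (Dom C g) \<Longrightarrow> t g x \<in> pts Y (Dom C g)"
  by (auto simp: maps_def)

lemma maps_natural:
  "t \<in> maps C V X Y \<Longrightarrow> g \<in> into C V \<Longrightarrow> x \<in> pts X (Dom C g) \<Longrightarrow> h \<in> into C (Dom C g) \<Longrightarrow>
    t (g \<cdot>\<^bsub>C\<^esub> h) (res X x h) = res Y (t g x) h"
  by (auto simp: maps_def)

text \<open>
  By Yoneda, an element \<open>f\<close> of \<open>X\<close> at stage \<open>U\<close> is a map from \<open>U\<close> to \<open>X\<close>; this is its composite with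
  \<open>\<psi>\<close>.
\<close>

lemma maps_element_of:
  assumes "presheaf C X" "f \<in> pts X U" "\<psi> \<in> maps C V D (object C U)"
  shows "(\<lambda>h d. res X f (\<psi> h d)) \<in> maps C V D X"
  unfolding maps_def
proof (intro CollectI ballI conjI)
  fix g d assume g: "g \<in> into C V" and d: "d \<in> pts D (Dom C g)"
  have \<psi>: "\<psi> g d \<in> Hom C (Dom C g) U"
    using maps_closed[OF assms(3) g d] by (simp add: object_def)
  show "res X f (\<psi> g d) \<in> pts X (Dom C g)"
    using presheafD(1)[OF assms(1,2) Hom_into[OF \<psi>]] Hom_Dom[OF \<psi>] by simp
  fix h assume h: "h \<in> into C (Dom C g)"
  have "res X f (\<psi> g d \<cdot>\<^bsub>C\<^esub> h) = res X (res X f (\<psi> g d)) h"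
    using presheafD(2)[OF assms(1,2) Hom_into[OF \<psi>]] Hom_Dom[OF \<psi>] h by simp
  then show "res X f (\<psi> (g \<cdot>\<^bsub>C\<^esub> h) (res D d h)) = res X (res X f (\<psi> g d)) h"
    using maps_natural[OF assms(3) g d h] by (simp add: object_def)
qed

locale ring_in_category = category C for C :: "('o, 'a) cat" (structure) +
  fixes R :: "'o \<Rightarrow> 'a ring"
  assumes ring_object: "ring_object C R"
begin

lemma R_cring: "V \<in> Ob C \<Longrightarrow> plain_cring (R V)"
  using ring_object by (simp add: ring_object_def plain_cring_def)

lemma R_hom:
  assumes "g \<in> into C V"
  shows "ring_hom_cring (R V) (R (Dom C g)) (\<lambda>x. x \<cdot> g)"
  using ring_object assms into_Ob[OF assms]
  by (auto simp: ring_object_def ring_hom_cring_def ring_hom_cring_axioms_def into_def)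

lemma R_restrict:
  assumes "g \<in> into C V" "x \<in> carrier (R V)"
  shows "x \<cdot> g \<in> carrier (R (Dom C g))"
    and "h \<in> into C (Dom C g) \<Longrightarrow> x \<cdot> (g \<cdot> h) = x \<cdot> g \<cdot> h"
proof -
  obtain X where X: "\<And>V. V \<in> Ob C \<Longrightarrow> carrier (R V) = Hom C V X"
    using ring_object by (auto simp: ring_object_def)
  show "x \<cdot> g \<in> carrier (R (Dom C g))"
    using assms into_Ob[OF assms(1)] by (auto simp: X into_iff_Hom intro: Comp_Hom)
  show "x \<cdot> (g \<cdot> h) = x \<cdot> g \<cdot> h" if "h \<in> into C (Dom C g)"
    using assms into_Ob[OF assms(1)] that Comp_assoc by (auto simp: X into_iff_Hom)
qed

lemma presheaf_ring_space: "presheaf C (ring_space C R)"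
  unfolding presheaf_def ring_space_def using R_restrict by auto

lemma presheaf_Rn: "presheaf C (Rn C R n)"
  unfolding Rn_def by (intro presheaf_power_space presheaf_ring_space)

lemma pts_Rn: "pts (Rn C R n) V = vectors (R V) n"
  by (auto simp: Rn_def power_space_def ring_space_def vectors_def)

lemma res_Rn: "res (Rn C R n) v g = map (\<lambda>x. x \<cdot> g) v"
  by (simp add: Rn_def power_space_def ring_space_def)

lemma pts_Dk: "pts (Dk C R k n) V = {d \<in> vectors (R V) n.
    \<forall>j. (\<forall>l\<le>k. j l < n) \<longrightarrow> (\<Otimes>\<^bsub>R V\<^esub>l\<in>{..k}. d ! j l) = \<zero>\<^bsub>R V\<^esub>}"
  by (simp add: Dk_def subspace_def pts_Rn)

lemma res_Dk: "res (Dk C R k n) = res (Rn C R n)"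
  by (simp add: Dk_def subspace_def)

lemma DkD:
  assumes "d \<in> pts (Dk C R k n) V"
  shows "d \<in> vectors (R V) n"
    and "\<forall>l\<le>k. j l < n \<Longrightarrow> (\<Otimes>\<^bsub>R V\<^esub>l\<in>{..k}. d ! j l) = \<zero>\<^bsub>R V\<^esub>"
  using assms by (simp_all add: pts_Dk)

lemma pts_D1:
  assumes "V \<in> Ob C"
  shows "d \<in> pts (Dk C R 1 n) V \<longleftrightarrow>
    d \<in> vectors (R V) n \<and> (\<forall>i<n. \<forall>j<n. d ! i \<otimes>\<^bsub>R V\<^esub> d ! j = \<zero>\<^bsub>R V\<^esub>)"
proof -
  interpret plain_cring "R V" using assms by (rule R_cring)
  have *: "(\<Otimes>\<^bsub>R V\<^esub>l\<in>{..1}. d ! j l) = d ! j 0 \<otimes>\<^bsub>R V\<^esub> d ! j 1"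
    if "d \<in> vectors (R V) n" "\<forall>l\<le>1. j l < n" for j :: "nat \<Rightarrow> nat"
    using that by (intro finprod_two) (auto simp: vectors_iff)
  show ?thesis
  proof (intro iffI conjI allI impI)
    fix i j assume d: "d \<in> pts (Dk C R 1 n) V" and ij: "i < n" "j < n"
    let ?j = "\<lambda>l::nat. if l = 0 then i else j"
    have j: "\<forall>l\<le>1. ?j l < n" using ij by simp
    have "(\<Otimes>\<^bsub>R V\<^esub>l\<in>{..1}. d ! ?j l) = d ! i \<otimes>\<^bsub>R V\<^esub> d ! j"
      using *[OF DkD(1)[OF d] j] by simp
    then show "d ! i \<otimes>\<^bsub>R V\<^esub> d ! j = \<zero>\<^bsub>R V\<^esub>"
      using DkD(2)[OF d j] by simp
  next
    assume d: "d \<in> vectors (R V) n \<and> (\<forall>i<n. \<forall>j<n. d ! i \<otimes>\<^bsub>R V\<^esub> d ! j = \<zero>\<^bsub>R V\<^esub>)"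
    have "(\<Otimes>\<^bsub>R V\<^esub>l\<in>{..1}. d ! j l) = \<zero>\<^bsub>R V\<^esub>" if j: "\<forall>l\<le>1. j l < n" for j :: "nat \<Rightarrow> nat"
      using *[OF conjunct1[OF d] j] d j by simp
    then show "d \<in> pts (Dk C R 1 n) V" using d unfolding pts_Dk by blast
  qed (simp add: pts_Dk)
qed

lemma zero_product_restrict:
  assumes g: "g \<in> into C V" and "\<And>l. l \<in> I \<Longrightarrow> x l \<in> carrier (R V)"
    and "(\<Otimes>\<^bsub>R V\<^esub>l\<in>I. x l) = \<zero>\<^bsub>R V\<^esub>"
  shows "(\<Otimes>\<^bsub>R (Dom C g)\<^esub>l\<in>I. x l \<cdot> g) = \<zero>\<^bsub>R (Dom C g)\<^esub>"
proof -
  interpret ring_hom_cring "R V" "R (Dom C g)" "\<lambda>x. x \<cdot> g" using g by (rule R_hom)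
  show ?thesis using hom_finprod[of x I] hom_zero assms by (simp add: o_def Pi_iff)
qed

lemma vectors_restrict:
  assumes "g \<in> into C V" "v \<in> vectors (R V) n"
  shows "map (\<lambda>x. x \<cdot> g) v \<in> vectors (R (Dom C g)) n"
  using assms R_restrict(1) by (auto simp: vectors_iff)

lemma presheaf_Dk: "presheaf C (Dk C R k n)"
proof -
  have "map (\<lambda>x. x \<cdot> g) d \<in> pts (Dk C R k n) (Dom C g)"
    if "d \<in> pts (Dk C R k n) V" "g \<in> into C V" for V d g
  proof -
    have d: "d \<in> vectors (R V) n" using that by (simp add: pts_Dk)
    have "(\<Otimes>\<^bsub>R (Dom C g)\<^esub>l\<in>{..k}. map (\<lambda>x. x \<cdot> g) d ! j l) = \<zero>\<^bsub>R (Dom C g)\<^esub>"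
      if j: "\<forall>l\<le>k. j l < n" for j
    proof -
      have "(\<Otimes>\<^bsub>R (Dom C g)\<^esub>l\<in>{..k}. d ! j l \<cdot> g) = \<zero>\<^bsub>R (Dom C g)\<^esub>"
        using d \<open>d \<in> pts (Dk C R k n) V\<close> j \<open>g \<in> into C V\<close>
        by (intro zero_product_restrict) (auto simp: pts_Dk vectors_iff)
      moreover interpret plain_cring "R (Dom C g)"
        using into_Ob(1)[OF \<open>g \<in> into C V\<close>] by (rule R_cring)
      have "(\<Otimes>\<^bsub>R (Dom C g)\<^esub>l\<in>{..k}. map (\<lambda>x. x \<cdot> g) d ! j l) =
        (\<Otimes>\<^bsub>R (Dom C g)\<^esub>l\<in>{..k}. d ! j l \<cdot> g)"
        using d j \<open>g \<in> into C V\<close> R_restrict(1) by (intro finprod_cong') (auto simp: vectors_iff)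
      ultimately show ?thesis by simp
    qed
    then show ?thesis using vectors_restrict[OF \<open>g \<in> into C V\<close> d] by (simp add: pts_Dk)
  qed
  moreover have "pts (Dk C R k n) V \<subseteq> pts (Rn C R n) V" for V
    by (auto simp: pts_Dk pts_Rn)
  ultimately show ?thesis
    using presheaf_Rn[of n] unfolding presheaf_def by (fastforce simp: res_Dk res_Rn)
qed

lemma zero_Dk: "V \<in> Ob C \<Longrightarrow> replicate n \<zero>\<^bsub>R V\<^esub> \<in> pts (Dk C R k n) V"
proof -
  assume "V \<in> Ob C"
  then interpret plain_cring "R V" by (rule R_cring)
  have "(\<Otimes>\<^bsub>R V\<^esub>l\<in>{..k}. replicate n \<zero>\<^bsub>R V\<^esub> ! j l) = \<zero>\<^bsub>R V\<^esub>" if j: "\<forall>l\<le>k. j l < n" for j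
  proof -
    have "(\<Otimes>\<^bsub>R V\<^esub>l\<in>{..k}. replicate n \<zero>\<^bsub>R V\<^esub> ! j l) =
      replicate n \<zero>\<^bsub>R V\<^esub> ! j k \<otimes>\<^bsub>R V\<^esub> (\<Otimes>\<^bsub>R V\<^esub>l\<in>{..<k}. replicate n \<zero>\<^bsub>R V\<^esub> ! j l)"
      using j by (subst (1) lessThan_Suc_atMost[symmetric], subst lessThan_Suc, subst finprod_insert)
        (auto simp: Pi_iff)
    also have "\<dots> = \<zero>\<^bsub>R V\<^esub>" using j by (auto simp: Pi_iff intro!: l_null finprod_closed)
    finally show ?thesis .
  qed
  then show ?thesis by (auto simp: pts_Dk vectors_iff)
qed

lemma R_Ident: "W \<in> Ob C \<Longrightarrow> x \<in> carrier (R W) \<Longrightarrow> x \<cdot> Ident C W = x"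
  using ring_object Ident_right by (auto simp: ring_object_def)

lemma vectors_Ident: "W \<in> Ob C \<Longrightarrow> v \<in> vectors (R W) n \<Longrightarrow> map (\<lambda>x. x \<cdot> Ident C W) v = v"
  by (rule nth_equalityI) (auto simp: vectors_iff R_Ident)

lemma restrict_vadd:
  assumes g: "g \<in> into C V" and uv: "u \<in> vectors (R V) n" "v \<in> vectors (R V) n"
  shows "map (\<lambda>x. x \<cdot> g) (vadd (R V) u v) =
    vadd (R (Dom C g)) (map (\<lambda>x. x \<cdot> g) u) (map (\<lambda>x. x \<cdot> g) v)"
proof -
  interpret ring_hom_cring "R V" "R (Dom C g)" "\<lambda>x. x \<cdot> g" using g by (rule R_hom)
  show ?thesis using uv by (intro nth_equalityI) (auto simp: vectors_iff nth_vadd)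
qed

lemma restrict_vdiff:
  assumes g: "g \<in> into C V" and uv: "u \<in> vectors (R V) n" "v \<in> vectors (R V) n"
  shows "map (\<lambda>x. x \<cdot> g) (vdiff (R V) u v) =
    vdiff (R (Dom C g)) (map (\<lambda>x. x \<cdot> g) u) (map (\<lambda>x. x \<cdot> g) v)"
proof -
  interpret ring_hom_cring "R V" "R (Dom C g)" "\<lambda>x. x \<cdot> g" using g by (rule R_hom)
  show ?thesis using uv by (intro nth_equalityI) (auto simp: vectors_iff nth_vdiff a_minus_def)
qed

section \<open>Infinitesimals under changes of chart\<close>

text \<open>
  Formal openness only asserts that the values of \<open>t\<close> have preimages in \<open>U\<close>, one at a time.  Since \<open>U\<close>
  is a subspace the preimages are unique, hence they are natural in the stage and form a map.
\<close>

lemma formally_open_lift: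
  assumes X: "presheaf C X" and fo: "formally_open C R X V q f" and km: "1 \<le> k" "1 \<le> m"
    and g: "g \<in> into C V" and t: "t \<in> maps C (Dom C g) (Dk C R k m) X"
    and w: "w \<in> Hom C (Dom C g) (Dom C q)" "q \<cdot> w = g"
      "res X f w = t (Ident C (Dom C g)) (replicate m \<zero>\<^bsub>R (Dom C g)\<^esub>)"
  obtains \<psi> where "\<psi> \<in> maps C (Dom C g) (Dk C R k m) (object C (Dom C q))"
    and "\<And>h d. h \<in> into C (Dom C g) \<Longrightarrow> d \<in> pts (Dk C R k m) (Dom C h) \<Longrightarrow>
      q \<cdot> \<psi> h d = g \<cdot> h \<and> res X f (\<psi> h d) = t h d"
proof -
  have emb: "embedding C X V q f" using fo by (simp add: formally_open_def)
  then have q: "q \<in> Hom C (Dom C q) V" and f: "f \<in> pts X (Dom C q)"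
    by (auto simp: embedding_def into_iff_Hom)
  have "in_sub C X q f g (t (Ident C (Dom C g)) (replicate m \<zero>\<^bsub>R (Dom C g)\<^esub>))"
    using w unfolding in_sub_def by blast
  then have "in_sub C X q f (g \<cdot> h) (t h d)"
    if "h \<in> into C (Dom C g)" "d \<in> pts (Dk C R k m) (Dom C h)" for h d
    using fo km g t that unfolding formally_open_def by blast
  then have "\<exists>u. u \<in> Hom C (Dom C h) (Dom C q) \<and> q \<cdot> u = g \<cdot> h \<and> res X f u = t h d"
    if "h \<in> into C (Dom C g)" "d \<in> pts (Dk C R k m) (Dom C h)" for h d
    using that Comp_into(2)[OF g that(1)] unfolding in_sub_def by fastforce
  then obtain \<psi> where \<psi>: "\<And>h d. h \<in> into C (Dom C g) \<Longrightarrow> d \<in> pts (Dk C R k m) (Dom C h) \<Longrightarrow>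
      \<psi> h d \<in> Hom C (Dom C h) (Dom C q) \<and> q \<cdot> \<psi> h d = g \<cdot> h \<and> res X f (\<psi> h d) = t h d"
    by metis
  have "\<psi> (h \<cdot> h') (res (Dk C R k m) d h') = \<psi> h d \<cdot> h'"
    if h: "h \<in> into C (Dom C g)" and d: "d \<in> pts (Dk C R k m) (Dom C h)"
      and h': "h' \<in> into C (Dom C h)" for h d h'
  proof (rule embedding_unique[OF emb, where W = "Dom C h'"])
    have hh: "h \<cdot> h' \<in> into C (Dom C g)" "Dom C (h \<cdot> h') = Dom C h'"
      using Comp_into[OF h h'] .
    have d': "res (Dk C R k m) d h' \<in> pts (Dk C R k m) (Dom C (h \<cdot> h'))"
      using presheafD(1)[OF presheaf_Dk d h'] hh by simp
    show "Dom C h' \<in> Ob C" using into_Ob[OF h'] by simp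
    show "\<psi> (h \<cdot> h') (res (Dk C R k m) d h') \<in> Hom C (Dom C h') (Dom C q)"
      using \<psi>[OF hh(1) d'] hh(2) by simp
    have \<psi>h: "\<psi> h d \<in> Hom C (Dom C h) (Dom C q)" using \<psi>[OF h d] by simp
    have h'Hom: "h' \<in> Hom C (Dom C h') (Dom C h)" using h' by (simp add: into_iff_Hom)
    show "\<psi> h d \<cdot> h' \<in> Hom C (Dom C h') (Dom C q)"
      using Comp_Hom[OF \<psi>h h'Hom] .
    show "q \<cdot> \<psi> (h \<cdot> h') (res (Dk C R k m) d h') = q \<cdot> (\<psi> h d \<cdot> h')"
      using \<psi>[OF hh(1) d'] \<psi>[OF h d] Comp_assoc[OF q \<psi>h h'Hom]
        Comp_assoc[of g "Dom C g" V h "Dom C h" h' "Dom C h'"] g h h'Hom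
      by (simp add: into_iff_Hom)
    have "res X f (\<psi> h d \<cdot> h') = res X (res X f (\<psi> h d)) h'"
      using presheafD(2)[OF X f Hom_into[OF \<psi>h]] Hom_Dom[OF \<psi>h] h' by simp
    then show "res X f (\<psi> (h \<cdot> h') (res (Dk C R k m) d h')) = res X f (\<psi> h d \<cdot> h')"
      using \<psi>[OF hh(1) d'] \<psi>[OF h d] maps_natural[OF t h d h'] by simp
  qed
  then have "\<psi> \<in> maps C (Dom C g) (Dk C R k m) (object C (Dom C q))"
    using \<psi> by (auto simp: maps_def object_def)
  then show ?thesis using that \<psi> by blast
qed

end

text \<open>
  First-order neighbourhood in one given chart.  The chart lives at the codomain of \<open>g\<close> and the points
  at its domain, so that charts never have to be pulled back to a later stage.
\<close>

definition neighbours_in_chart ::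
    "('o, 'a) cat \<Rightarrow> ('o \<Rightarrow> 'a ring) \<Rightarrow> nat \<Rightarrow> 'a \<Rightarrow> 'a \<Rightarrow> 'a list \<Rightarrow> 'a \<Rightarrow> 'a \<Rightarrow> 'a \<Rightarrow> 'a \<Rightarrow> 'a \<Rightarrow> bool"
  where
  "neighbours_in_chart C R n q \<iota> \<phi> g P Q wP wQ \<longleftrightarrow>
    (\<forall>w\<in>{wP, wQ}. w \<in> Hom C (Dom C g) (Dom C q) \<and> q \<cdot>\<^bsub>C\<^esub> w = g) \<and>
    \<iota> \<cdot>\<^bsub>C\<^esub> wP = P \<and> \<iota> \<cdot>\<^bsub>C\<^esub> wQ = Q \<and>
    vdiff (R (Dom C g)) (res (Rn C R n) \<phi> wQ) (res (Rn C R n) \<phi> wP) \<in> pts (Dk C R 1 n) (Dom C g)"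

context ring_in_category
begin

lemma neighbours_in_chart_restrict:
  assumes q: "q \<in> into C W" and \<iota>: "\<iota> \<in> Hom C (Dom C q) A" and \<phi>: "\<phi> \<in> vectors (R (Dom C q)) n"
    and nb: "neighbours_in_chart C R n q \<iota> \<phi> g P Q wP wQ"
    and h: "h \<in> into C (Dom C g)"
  shows "neighbours_in_chart C R n q \<iota> \<phi> (g \<cdot> h) (P \<cdot> h) (Q \<cdot> h) (wP \<cdot> h) (wQ \<cdot> h)"
proof -
  have qHom: "q \<in> Hom C (Dom C q) W" and hHom: "h \<in> Hom C (Dom C h) (Dom C g)"
    using q h by (simp_all add: into_iff_Hom)
  have w: "w \<in> Hom C (Dom C g) (Dom C q)" "q \<cdot> w = g" if "w \<in> {wP, wQ}" for w
    using nb that by (auto simp: neighbours_in_chart_def)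
  have gh: "Dom C (g \<cdot> h) = Dom C h"
    using Hom_Dom[OF Comp_Hom[OF Comp_Hom[OF qHom w(1)[of wP]] hHom]] w(2)[of wP] by simp
  have wh: "w \<cdot> h \<in> Hom C (Dom C h) (Dom C q)" "q \<cdot> (w \<cdot> h) = g \<cdot> h"
    "\<iota> \<cdot> (w \<cdot> h) = \<iota> \<cdot> w \<cdot> h" if "w \<in> {wP, wQ}" for w
    using Comp_Hom[OF w(1)[OF that] hHom] Comp_assoc[OF qHom w(1)[OF that] hHom] w(2)[OF that]
      Comp_assoc[OF \<iota> w(1)[OF that] hHom] by simp_all
  let ?r = "\<lambda>w. res (Rn C R n) \<phi> w"
  have r: "?r w \<in> vectors (R (Dom C g)) n" "?r (w \<cdot> h) = map (\<lambda>x. x \<cdot> h) (?r w)"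
    if "w \<in> {wP, wQ}" for w
    using presheafD[OF presheaf_Rn, of \<phi> n "Dom C q" w] \<phi> Hom_into[OF w(1)[OF that]]
      Hom_Dom[OF w(1)[OF that]] h by (simp_all add: pts_Rn res_Rn)
  have "vdiff (R (Dom C g)) (?r wQ) (?r wP) \<in> pts (Dk C R 1 n) (Dom C g)"
    using nb by (simp add: neighbours_in_chart_def)
  from presheafD(1)[OF presheaf_Dk this h]
  have "vdiff (R (Dom C h)) (?r (wQ \<cdot> h)) (?r (wP \<cdot> h)) \<in> pts (Dk C R 1 n) (Dom C h)"
    using restrict_vdiff[OF h r(1)[of wQ] r(1)[of wP]] r(2)[of wQ] r(2)[of wP]
    unfolding res_Dk res_Rn[of n "vdiff _ _ _"] by simp
  then show ?thesis
    using nb wh unfolding neighbours_in_chart_def gh by auto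
qed

lemma kock_lawvere_annihilator:
  assumes KL: "kock_lawvere C R" and kn: "1 \<le> k" "1 \<le> n" and W: "W \<in> Ob C"
    and t: "t \<in> maps C W (Dk C R k n) (ring_space C R)" and d: "d \<in> pts (Dk C R k n) W"
    and c: "c \<in> carrier (R W)" and ann: "\<And>i. i < n \<Longrightarrow> c \<otimes>\<^bsub>R W\<^esub> d ! i = \<zero>\<^bsub>R W\<^esub>"
  shows "c \<otimes>\<^bsub>R W\<^esub> (t (Ident C W) d \<ominus>\<^bsub>R W\<^esub> t (Ident C W) (replicate n \<zero>\<^bsub>R W\<^esub>)) = \<zero>\<^bsub>R W\<^esub>"
proof -
  interpret plain_cring "R W" using W by (rule R_cring)
  obtain a where a: "a \<in> exponents n k \<rightarrow>\<^sub>E carrier (R W)"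
    and ta: "\<And>g d. g \<in> into C W \<Longrightarrow> d \<in> pts (Dk C R k n) (Dom C g) \<Longrightarrow>
      t g d = poly_value (R (Dom C g)) n k (\<lambda>\<alpha>. a \<alpha> \<cdot> g) d"
    using KL[unfolded kock_lawvere_def, rule_format, OF kn W t] by (elim ex1E conjE) blast
  let ?I = "Ident C W" and ?z = "replicate n \<zero>\<^bsub>R W\<^esub>"
  note I = Ident_into[OF W]
  have "(\<lambda>\<alpha>. a \<alpha> \<cdot> ?I) \<in> exponents n k \<rightarrow> carrier (R W)"
    using a R_Ident[OF W] by (auto simp: PiE_def Pi_iff)
  note poly = annihilator_poly_value[OF c this DkD(1)[OF d] ann]
  have z: "?z \<in> pts (Dk C R k n) W" using zero_Dk[OF W] .
  have "t ?I d \<in> carrier (R W)" "t ?I ?z \<in> carrier (R W)"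
    using maps_closed[OF t I(1)] d z I(2) by (simp_all add: ring_space_def)
  moreover have "c \<otimes>\<^bsub>R W\<^esub> t ?I d = c \<otimes>\<^bsub>R W\<^esub> t ?I ?z"
    using poly ta[OF I(1)] I(2) d z by simp
  ultimately show ?thesis
    using c by (simp add: a_minus_def r_distr r_minus r_neg)
qed

text \<open>
  A map out of \<open>D\<^sub>1(n)\<close> moves the point 0 only to first order: by the Kock--Lawvere axiom the difference
  \<open>t(d) - t(0)\<close> is polynomial in \<open>d\<close> without constant term, and all \<open>d\<^sub>i d\<^sub>j\<close> vanish.  Concretely, \<open>d\<^sub>i\<close>
  annihilates all \<open>d\<^sub>j\<close>, hence \<open>t(d) - t(0)\<close>; so \<open>t(d) - t(0)\<close> annihilates all \<open>d\<^sub>j\<close>, hence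
  \<open>s(d) - s(0)\<close>.
\<close>

lemma kock_lawvere_differences:
  assumes KL: "kock_lawvere C R" and n: "1 \<le> n" and W: "W \<in> Ob C"
    and t: "t \<in> maps C W (Dk C R 1 n) (ring_space C R)"
    and s: "s \<in> maps C W (Dk C R 1 n) (ring_space C R)"
    and d: "d \<in> pts (Dk C R 1 n) W"
  shows "(t (Ident C W) d \<ominus>\<^bsub>R W\<^esub> t (Ident C W) (replicate n \<zero>\<^bsub>R W\<^esub>)) \<otimes>\<^bsub>R W\<^esub>
    (s (Ident C W) d \<ominus>\<^bsub>R W\<^esub> s (Ident C W) (replicate n \<zero>\<^bsub>R W\<^esub>)) = \<zero>\<^bsub>R W\<^esub>"
proof -
  interpret plain_cring "R W" using W by (rule R_cring)
  let ?I = "Ident C W" and ?z = "replicate n \<zero>\<^bsub>R W\<^esub>"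
  have closed: "r ?I e \<in> carrier (R W)"
    if "r \<in> maps C W (Dk C R 1 n) (ring_space C R)" "e \<in> pts (Dk C R 1 n) W" for r e
    using maps_closed[OF that(1) Ident_into(1)[OF W]] Ident_into(2)[OF W] that(2)
    by (simp add: ring_space_def)
  have z: "?z \<in> pts (Dk C R 1 n) W" using zero_Dk[OF W] .
  have di: "d ! i \<in> carrier (R W)" if "i < n" for i
    using DkD(1)[OF d] that by (simp add: vectors_iff)
  have dd: "d ! i \<otimes>\<^bsub>R W\<^esub> d ! j = \<zero>\<^bsub>R W\<^esub>" if "i < n" "j < n" for i j
    using d that unfolding pts_D1[OF W] by blast
  have T: "t ?I d \<ominus>\<^bsub>R W\<^esub> t ?I ?z \<in> carrier (R W)" using closed[OF t] d z by simp
  have "(t ?I d \<ominus>\<^bsub>R W\<^esub> t ?I ?z) \<otimes>\<^bsub>R W\<^esub> d ! i = \<zero>\<^bsub>R W\<^esub>" if i: "i < n" for i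
    using kock_lawvere_annihilator[OF KL _ n W t d di[OF i]] dd[OF i] T di[OF i]
    by (simp add: m_comm)
  then show ?thesis using kock_lawvere_annihilator[OF KL _ n W s d T] by simp
qed

text \<open>
  Being first-order neighbours does not depend on the chart, as soon as one of the two points lies in
  the second chart.  In the first chart \<open>Q = P + d\<close> with \<open>d\<close> in \<open>D\<^sub>1(n)\<close>, and \<open>e \<mapsto> P + e\<close> is a map from \<open>D\<^sub>1(n)\<close>
  to \<open>A\<close> because the first chart is formally open in \<open>R\<^sup>n\<close>.  It takes its values in the second chart
  because that one is formally open in \<open>A\<close>.  Its coordinates there are maps \<open>D\<^sub>1(n) \<rightarrow> R\<close>, to which
  \<open>kock_lawvere_differences\<close> applies.
\<close>

lemma chart_transfer:
  assumes KL: "kock_lawvere C R"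
    and ch: "chart C R n A W q \<iota> \<phi>" and k: "k \<in> into C W"
    and nb: "neighbours_in_chart C R n q \<iota> \<phi> k P Q wP wQ"
    and ch': "chart C R n A (Dom C k) q' \<iota>' \<phi>'"
    and wP': "wP' \<in> Hom C (Dom C k) (Dom C q')" "q' \<cdot> wP' = Ident C (Dom C k)" "\<iota>' \<cdot> wP' = P"
  obtains wQ' where
    "neighbours_in_chart C R n q' \<iota>' \<phi>' (Ident C (Dom C k)) P Q wP' wQ'"
proof -
  let ?W = "Dom C k"
  let ?I = "Ident C ?W" and ?z = "replicate n \<zero>\<^bsub>R ?W\<^esub>"
  have W: "?W \<in> Ob C" using into_Ob[OF k] by simp
  note I = Ident_into[OF W]
  interpret plain_cring "R ?W" using W by (rule R_cring)
  have fo: "formally_open C R (object C A) W q \<iota>" "formally_open C R (Rn C R n) W q \<phi>"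
    and fo': "formally_open C R (object C A) ?W q' \<iota>'" "formally_open C R (Rn C R n) ?W q' \<phi>'"
    using ch ch' by (simp_all add: chart_def)
  then have emb: "embedding C (Rn C R n) W q \<phi>" and emb': "embedding C (object C A) ?W q' \<iota>'"
    by (simp_all add: formally_open_def)
  have \<phi>: "\<phi> \<in> vectors (R (Dom C q)) n" and \<phi>': "\<phi>' \<in> vectors (R (Dom C q')) n"
    and \<iota>: "\<iota> \<in> pts (object C A) (Dom C q)"
    using fo fo' by (simp_all add: formally_open_def embedding_def pts_Rn)
  have wP: "wP \<in> Hom C ?W (Dom C q)" "q \<cdot> wP = k" "\<iota> \<cdot> wP = P"
    and wQ: "wQ \<in> Hom C ?W (Dom C q)" "q \<cdot> wQ = k" "\<iota> \<cdot> wQ = Q"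
    using nb by (simp_all add: neighbours_in_chart_def)
  let ?p = "res (Rn C R n) \<phi> wP"
  let ?d = "vdiff (R ?W) (res (Rn C R n) \<phi> wQ) ?p"
  have d: "?d \<in> pts (Dk C R 1 n) ?W" using nb by (simp add: neighbours_in_chart_def)
  have p: "?p \<in> vectors (R ?W) n" and r: "res (Rn C R n) \<phi> wQ \<in> vectors (R ?W) n"
    using vectors_restrict[OF Hom_into[OF wP(1)] \<phi>] vectors_restrict[OF Hom_into[OF wQ(1)] \<phi>]
      Hom_Dom[OF wP(1)] Hom_Dom[OF wQ(1)] by (simp_all add: res_Rn)
  show ?thesis
  proof (cases "n = 0")
    case True
    \<comment> \<open>Formal openness does not cover \<open>D\<^sub>1(0)\<close>, but a chart into \<open>R\<^sup>0\<close> has at most one point.\<close>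
    have "wP = wQ"
      by (rule embedding_unique[OF emb wP(1) wQ(1) W])
        (use wP wQ \<phi> True in \<open>simp_all add: res_Rn vectors_iff\<close>)
    then have "Q = P" using wP wQ by simp
    moreover have "vdiff (R ?W) v v \<in> pts (Dk C R 1 n) ?W" if "v = res (Rn C R n) \<phi>' w" for v w
      unfolding pts_D1[OF W] using that \<phi>' True by (simp add: vectors_iff res_Rn)
    ultimately show ?thesis
      using that[of wP'] wP' I(2) by (simp add: neighbours_in_chart_def)
  next
    case False
    then have n: "1 \<le> n" by simp
    \<comment> \<open>\<open>e \<mapsto> P + e\<close>: as \<open>t\<close> in \<open>R\<^sup>n\<close>, as \<open>\<psi>\<close> in the first chart, as \<open>s\<close> in \<open>A\<close>, as \<open>\<psi>'\<close> in the second chart\<close>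
    define t where "t h e = vadd (R (Dom C h)) (map (\<lambda>x. x \<cdot> h) ?p) e" for h e
    have t: "t \<in> maps C ?W (Dk C R 1 n) (Rn C R n)"
      unfolding maps_def
    proof (intro CollectI ballI conjI)
      fix g e assume g: "g \<in> into C ?W" and e: "e \<in> pts (Dk C R 1 n) (Dom C g)"
      have pg: "map (\<lambda>x. x \<cdot> g) ?p \<in> vectors (R (Dom C g)) n" by (rule vectors_restrict[OF g p])
      show "t g e \<in> pts (Rn C R n) (Dom C g)"
        unfolding t_def pts_Rn
        by (rule plain_cring.vadd_closed[OF R_cring pg DkD(1)[OF e]]) (use into_Ob[OF g] in simp)
      fix h assume h: "h \<in> into C (Dom C g)"
      have "map (\<lambda>x. x \<cdot> (g \<cdot> h)) ?p = map (\<lambda>x. x \<cdot> h) (map (\<lambda>x. x \<cdot> g) ?p)"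
        using p g h R_restrict(2) by (intro nth_equalityI) (auto simp: vectors_iff)
      then show "t (g \<cdot> h) (res (Dk C R 1 n) e h) = res (Rn C R n) (t g e) h"
        using restrict_vadd[OF h pg DkD(1)[OF e]] Comp_into(2)[OF g h]
        by (simp only: t_def res_Dk res_Rn)
    qed
    have tz: "t ?I ?z = ?p" and td: "t ?I ?d = res (Rn C R n) \<phi> wQ"
      using vadd_zero[OF p] vadd_vdiff[OF p r] vectors_Ident[OF W p] I(2) by (simp_all add: t_def)
    obtain \<psi> where \<psi>: "\<psi> \<in> maps C ?W (Dk C R 1 n) (object C (Dom C q))"
      and \<psi>q: "\<And>h e. h \<in> into C ?W \<Longrightarrow> e \<in> pts (Dk C R 1 n) (Dom C h) \<Longrightarrow>
        q \<cdot> \<psi> h e = k \<cdot> h \<and> res (Rn C R n) \<phi> (\<psi> h e) = t h e"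
      using formally_open_lift[OF presheaf_Rn fo(2) _ n k t wP(1,2)] tz by auto
    have z: "?z \<in> pts (Dk C R 1 n) ?W" by (rule zero_Dk[OF W])
    have kI: "k \<cdot> ?I = k" using k Ident_right by (auto simp: into_iff_Hom)
    have \<psi>Hom: "\<psi> ?I e \<in> Hom C ?W (Dom C q)" if "e \<in> pts (Dk C R 1 n) ?W" for e
      using maps_closed[OF \<psi> I(1)] I(2) that by (simp add: object_def)
    have \<psi>z: "\<psi> ?I ?z = wP"
      using embedding_unique[OF emb \<psi>Hom[OF z] wP(1) W] \<psi>q[OF I(1)] I(2) z kI wP(2) tz by simp
    have \<psi>d: "\<psi> ?I ?d = wQ"
      using embedding_unique[OF emb \<psi>Hom[OF d] wQ(1) W] \<psi>q[OF I(1)] I(2) d kI wQ(2) td by simp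
    define s where "s = (\<lambda>h e. \<iota> \<cdot> \<psi> h e)"
    have s: "s \<in> maps C ?W (Dk C R 1 n) (object C A)"
      using maps_element_of[OF presheaf_object \<iota> \<psi>] by (simp add: s_def object_def)
    have sz: "s ?I ?z = P" and sd: "s ?I ?d = Q" using \<psi>z \<psi>d wP wQ by (simp_all add: s_def)
    obtain \<psi>' where \<psi>': "\<psi>' \<in> maps C ?W (Dk C R 1 n) (object C (Dom C q'))"
      and \<psi>'q: "\<And>h e. h \<in> into C ?W \<Longrightarrow> e \<in> pts (Dk C R 1 n) (Dom C h) \<Longrightarrow>
        q' \<cdot> \<psi>' h e = ?I \<cdot> h \<and> \<iota>' \<cdot> \<psi>' h e = s h e"
      using formally_open_lift[OF presheaf_object fo'(1) _ n I(1), of 1 s wP'] s wP' sz I(2)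
      by (auto simp: object_def)
    have II: "?I \<cdot> ?I = ?I" using Ident_left[OF Ident_Hom[OF W]] .
    have \<psi>'Hom: "\<psi>' ?I e \<in> Hom C ?W (Dom C q')" if "e \<in> pts (Dk C R 1 n) ?W" for e
      using maps_closed[OF \<psi>' I(1)] I(2) that by (simp add: object_def)
    have \<psi>'z: "\<psi>' ?I ?z = wP'"
      using embedding_unique[OF emb' \<psi>'Hom[OF z] wP'(1) W] \<psi>'q[OF I(1)] I(2) z II wP'(2,3) sz
      by (simp add: object_def)
    let ?wQ = "\<psi>' ?I ?d"
    have coordinate: "(\<lambda>h e. (\<phi>' ! i) \<cdot> \<psi>' h e) \<in> maps C ?W (Dk C R 1 n) (ring_space C R)"
      if "i < n" for i
      using maps_element_of[OF presheaf_ring_space, of "\<phi>' ! i" "Dom C q'", OF _ \<psi>'] \<phi>' that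
      by (simp add: ring_space_def vectors_iff)
    have vec: "res (Rn C R n) \<phi>' w \<in> vectors (R ?W) n" if "w \<in> Hom C ?W (Dom C q')" for w
      using vectors_restrict[OF Hom_into[OF that] \<phi>'] Hom_Dom[OF that] by (simp add: res_Rn)
    let ?d' = "vdiff (R ?W) (res (Rn C R n) \<phi>' ?wQ) (res (Rn C R n) \<phi>' wP')"
    have d': "?d' ! i = (\<phi>' ! i \<cdot> \<psi>' ?I ?d) \<ominus>\<^bsub>R ?W\<^esub> (\<phi>' ! i \<cdot> \<psi>' ?I ?z)" if "i < n" for i
      using that \<phi>' \<psi>'z by (simp add: nth_vdiff res_Rn vectors_iff)
    have "?d' \<in> pts (Dk C R 1 n) ?W"
      unfolding pts_D1[OF W]
    proof (intro conjI allI impI)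
      show "?d' \<in> vectors (R ?W) n"
        by (rule vdiff_closed[OF vec[OF \<psi>'Hom[OF d]] vec[OF wP'(1)]])
      show "?d' ! i \<otimes>\<^bsub>R ?W\<^esub> ?d' ! j = \<zero>\<^bsub>R ?W\<^esub>" if "i < n" "j < n" for i j
        unfolding d'[OF that(1)] d'[OF that(2)]
        by (rule kock_lawvere_differences[OF KL n W coordinate coordinate d]) (use that in simp_all)
    qed
    then show ?thesis
      using that[of ?wQ] \<psi>'q[OF I(1)] \<psi>'Hom[OF d] I(2) d II wP' sd
      by (simp add: neighbours_in_chart_def)
  qed
qed

section \<open>Second-order neighbourhoods\<close>

text \<open>
  The quantification over all multilinear maps, at all later stages, reduces to the products of
  coordinates, since these are preserved by restriction.
\<close>

lemma DN_intro:
  assumes V: "V \<in> Ob C" and vs: "length vs = k + 1" "set vs \<subseteq> pts (Dk C R k n) V"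
    and mixed: "\<And>i. (\<And>l. l \<le> k \<Longrightarrow> i l < n) \<Longrightarrow> (\<Otimes>\<^bsub>R V\<^esub>l\<in>{..k}. vs ! l ! i l) = \<zero>\<^bsub>R V\<^esub>"
  shows "vs \<in> pts (DN C R k n) V"
proof -
  have vsl: "vs ! l \<in> vectors (R V) n" if "l \<le> k" for l
    using vs that DkD(1) by (metis less_Suc_eq_le Suc_eq_plus1 nth_mem subsetD)
  have "\<phi> (Ident C (Dom C g)) (map (\<lambda>v. map (\<lambda>x. x \<cdot> g) v) vs) = \<zero>\<^bsub>R (Dom C g)\<^esub>"
    if g: "g \<in> into C V" and \<phi>: "\<phi> \<in> multilinear_maps C R n (k + 1) (Dom C g)" for g \<phi>
  proof -
    let ?W = "Dom C g" and ?vs = "map (\<lambda>v. map (\<lambda>x. x \<cdot> g) v) vs"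
    have W: "?W \<in> Ob C" using into_Ob[OF g] by simp
    note I = Ident_into[OF W]
    interpret plain_cring "R ?W" using W by (rule R_cring)
    have pts: "us \<in> pts (power_space (Rn C R n) (k + 1)) ?W \<longleftrightarrow>
      length us = k + 1 \<and> set us \<subseteq> vectors (R ?W) n" for us
      by (simp add: power_space_def pts_Rn)
    have \<phi>maps: "\<phi> \<in> maps C ?W (power_space (Rn C R n) (k + 1)) (ring_space C R)"
      and \<phi>lin: "\<forall>g'\<in>into C ?W. \<forall>vs\<in>pts (power_space (Rn C R n) (k + 1)) (Dom C g'). \<forall>l<k + 1.
        (\<forall>u\<in>pts (Rn C R n) (Dom C g'). \<forall>v\<in>pts (Rn C R n) (Dom C g').
          \<phi> g' (vs[l := vadd (R (Dom C g')) u v]) =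
            \<phi> g' (vs[l := u]) \<oplus>\<^bsub>R (Dom C g')\<^esub> \<phi> g' (vs[l := v])) \<and>
        (\<forall>a\<in>carrier (R (Dom C g')). \<forall>u\<in>pts (Rn C R n) (Dom C g').
          \<phi> g' (vs[l := vscale (R (Dom C g')) a u]) = a \<otimes>\<^bsub>R (Dom C g')\<^esub> \<phi> g' (vs[l := u]))"
      using \<phi> by (simp_all add: multilinear_maps_def)
    note lin = bspec[OF \<phi>lin I(1), unfolded I(2), rule_format, unfolded pts pts_Rn]
    show ?thesis
    proof (rule multilinear_vanishes[where r = "k + 1" and n = n])
      fix us :: "'a list list" assume "length us = k + 1" "set us \<subseteq> vectors (R ?W) n"
      then show "\<phi> (Ident C ?W) us \<in> carrier (R ?W)"
        using maps_closed[OF \<phi>maps I(1)] I(2) pts[of us] by (simp add: ring_space_def)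
    next
      fix us l u v
      assume "length us = k + 1" "set us \<subseteq> vectors (R ?W) n" "l < k + 1"
        "u \<in> vectors (R ?W) n" "v \<in> vectors (R ?W) n"
      then show "\<phi> (Ident C ?W) (us[l := vadd (R ?W) u v]) =
        \<phi> (Ident C ?W) (us[l := u]) \<oplus>\<^bsub>R ?W\<^esub> \<phi> (Ident C ?W) (us[l := v])"
        using lin by blast
    next
      fix us l a u
      assume "length us = k + 1" "set us \<subseteq> vectors (R ?W) n" "l < k + 1"
        "a \<in> carrier (R ?W)" "u \<in> vectors (R ?W) n"
      then show "\<phi> (Ident C ?W) (us[l := vscale (R ?W) a u]) =
        a \<otimes>\<^bsub>R ?W\<^esub> \<phi> (Ident C ?W) (us[l := u])"
        using lin by blast
    next
      show "length ?vs = k + 1" using vs by simp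
      show "set ?vs \<subseteq> vectors (R ?W) n"
        using vs(2) vectors_restrict[OF g] by (auto dest: DkD(1))
    next
      fix i :: "nat \<Rightarrow> nat" assume i: "\<And>l. l < k + 1 \<Longrightarrow> i l < n"
      have coord: "?vs ! l ! i l = vs ! l ! i l \<cdot> g" "vs ! l ! i l \<in> carrier (R V)" if "l \<le> k" for l
        using vsl[OF that] vs(1) that i[of l] by (simp_all add: vectors_iff)
      have "(\<Otimes>\<^bsub>R ?W\<^esub>l\<in>{..k}. vs ! l ! i l \<cdot> g) = \<zero>\<^bsub>R ?W\<^esub>"
        by (rule zero_product_restrict[OF g]) (use coord mixed i in simp_all)
      moreover have "(\<Otimes>\<^bsub>R ?W\<^esub>l\<in>{..k}. ?vs ! l ! i l) = (\<Otimes>\<^bsub>R ?W\<^esub>l\<in>{..k}. vs ! l ! i l \<cdot> g)"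
        using coord R_restrict(1)[OF g] by (intro finprod_cong') auto
      ultimately show "(\<Otimes>\<^bsub>R ?W\<^esub>l\<in>{..<k + 1}. ?vs ! l ! i l) = \<zero>\<^bsub>R ?W\<^esub>"
        by (simp add: lessThan_Suc_atMost)
    qed
  qed
  then show ?thesis
    using vs unfolding DN_def subspace_def by (simp add: power_space_def res_Rn)
qed

text \<open>
  Put \<open>d = q - p\<close> and \<open>e = s - p\<close>.  All differences of two of the three points are combinations of \<open>d\<close> and
  \<open>e\<close> with coefficients 0, 1 and -1.  A product of three of their coordinates therefore expands into
  terms with two coordinates of \<open>d\<close> or two coordinates of \<open>e\<close>, all of which vanish.
\<close>

lemma Rn_nbhd_triple:
  assumes V: "V \<in> Ob C" and pqs: "p \<in> vectors (R V) n" "q \<in> vectors (R V) n" "s \<in> vectors (R V) n"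
    and q: "vdiff (R V) q p \<in> pts (Dk C R 1 n) V" and s: "vdiff (R V) s p \<in> pts (Dk C R 1 n) V"
  shows "[p, q, s] \<in> pts (Rn_nbhd C R n 2 3) V"
proof -
  interpret plain_cring "R V" using V by (rule R_cring)
  let ?P = "[p, q, s]"
  \<comment> \<open>The sets of the elements that \<open>d\<close> and \<open>e\<close> contribute to coordinates of differences.\<close>
  define N where "N d = {\<zero>\<^bsub>R V\<^esub>} \<union> (\<Union>a<n. {d ! a, \<ominus>\<^bsub>R V\<^esub> (d ! a)})" for d
  let ?d = "vdiff (R V) q p" and ?e = "vdiff (R V) s p"
  have N: "N d \<subseteq> carrier (R V)" "\<And>u v. u \<in> N d \<Longrightarrow> v \<in> N d \<Longrightarrow> u \<otimes>\<^bsub>R V\<^esub> v = \<zero>\<^bsub>R V\<^esub>"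
    if d: "d \<in> pts (Dk C R 1 n) V" for d
  proof -
    have c: "\<And>a. a < n \<Longrightarrow> d ! a \<in> carrier (R V)"
      and dd: "\<And>a b. a < n \<Longrightarrow> b < n \<Longrightarrow> d ! a \<otimes>\<^bsub>R V\<^esub> d ! b = \<zero>\<^bsub>R V\<^esub>"
      using d unfolding pts_D1[OF V] by (auto simp: vectors_iff)
    show "N d \<subseteq> carrier (R V)" using c by (auto simp: N_def)
    show "u \<otimes>\<^bsub>R V\<^esub> v = \<zero>\<^bsub>R V\<^esub>" if "u \<in> N d" "v \<in> N d" for u v
      using that c dd by (auto simp: N_def l_minus r_minus)
  qed
  have split: "\<exists>u\<in>N ?d. \<exists>v\<in>N ?e. vdiff (R V) (?P ! i) (?P ! j) ! a = u \<oplus>\<^bsub>R V\<^esub> v"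
    if "i < 3" "j < 3" and a: "a < n" for i j a
  proof -
    define x y z where "x = p ! a" and "y = q ! a" and "z = s ! a"
    have c: "x \<in> carrier (R V)" "y \<in> carrier (R V)" "z \<in> carrier (R V)"
      using pqs a by (simp_all add: x_def y_def z_def vectors_iff)
    have len: "length p = n" "length q = n" "length s = n" using pqs by (simp_all add: vectors_iff)
    have mem: "\<zero>\<^bsub>R V\<^esub> \<in> N d" "a < length d \<Longrightarrow> d ! a \<in> N d" "\<ominus>\<^bsub>R V\<^esub> (d ! a) \<in> N d" for d
      using a by (auto simp: N_def)
    have d: "?d ! a = y \<ominus>\<^bsub>R V\<^esub> x" and e: "?e ! a = z \<ominus>\<^bsub>R V\<^esub> x"
      using len a by (simp_all add: nth_vdiff x_def y_def z_def)
    have memd: "y \<ominus>\<^bsub>R V\<^esub> x \<in> N ?d" "\<ominus>\<^bsub>R V\<^esub> (y \<ominus>\<^bsub>R V\<^esub> x) \<in> N ?d"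
      and meme: "z \<ominus>\<^bsub>R V\<^esub> x \<in> N ?e" "\<ominus>\<^bsub>R V\<^esub> (z \<ominus>\<^bsub>R V\<^esub> x) \<in> N ?e"
      using mem(2,3)[of ?d] mem(2,3)[of ?e] len a by (simp_all add: d e)
    have alg: "y \<ominus>\<^bsub>R V\<^esub> z = (y \<ominus>\<^bsub>R V\<^esub> x) \<oplus>\<^bsub>R V\<^esub> \<ominus>\<^bsub>R V\<^esub> (z \<ominus>\<^bsub>R V\<^esub> x)"
      "z \<ominus>\<^bsub>R V\<^esub> y = \<ominus>\<^bsub>R V\<^esub> (y \<ominus>\<^bsub>R V\<^esub> x) \<oplus>\<^bsub>R V\<^esub> (z \<ominus>\<^bsub>R V\<^esub> x)"
      "x \<ominus>\<^bsub>R V\<^esub> y = \<ominus>\<^bsub>R V\<^esub> (y \<ominus>\<^bsub>R V\<^esub> x) \<oplus>\<^bsub>R V\<^esub> \<zero>\<^bsub>R V\<^esub>"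
      "x \<ominus>\<^bsub>R V\<^esub> z = \<zero>\<^bsub>R V\<^esub> \<oplus>\<^bsub>R V\<^esub> \<ominus>\<^bsub>R V\<^esub> (z \<ominus>\<^bsub>R V\<^esub> x)"
      "y \<ominus>\<^bsub>R V\<^esub> x = (y \<ominus>\<^bsub>R V\<^esub> x) \<oplus>\<^bsub>R V\<^esub> \<zero>\<^bsub>R V\<^esub>"
      "z \<ominus>\<^bsub>R V\<^esub> x = \<zero>\<^bsub>R V\<^esub> \<oplus>\<^bsub>R V\<^esub> (z \<ominus>\<^bsub>R V\<^esub> x)"
      using c by algebra+
    have diag: "w \<ominus>\<^bsub>R V\<^esub> w = \<zero>\<^bsub>R V\<^esub> \<oplus>\<^bsub>R V\<^esub> \<zero>\<^bsub>R V\<^esub>" if "w \<in> carrier (R V)" for w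
      using that by (simp add: minus_eq r_neg)
    have "i \<in> {0, 1, 2}" "j \<in> {0, 1, 2}" using that by auto
    then consider "(i, j) = (1, 2)" | "(i, j) = (2, 1)" | "(i, j) = (0, 1)" | "(i, j) = (0, 2)"
      | "(i, j) = (1, 0)" | "(i, j) = (2, 0)" | "i = j" by auto
    then show ?thesis
    proof cases
      case 7
      have "vdiff (R V) (?P ! i) (?P ! j) ! a = \<zero>\<^bsub>R V\<^esub> \<oplus>\<^bsub>R V\<^esub> \<zero>\<^bsub>R V\<^esub>"
        using 7 \<open>i \<in> {0, 1, 2}\<close> len a c diag
        by (auto simp: nth_vdiff simp flip: x_def y_def z_def)
      then show ?thesis using mem(1) by blast
    qed (use len a in \<open>simp add: nth_vdiff flip: x_def y_def z_def\<close>;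
         use alg memd meme mem(1) in blast)+
  qed
  have triple: "(\<Otimes>\<^bsub>R V\<^esub>l\<in>{..2}. vdiff (R V) (?P ! i l) (?P ! j l) ! a l) = \<zero>\<^bsub>R V\<^esub>"
    if i: "\<forall>l\<le>2. i l < 3 \<and> j l < 3" and a: "\<forall>l\<le>2. a l < n" for i j a :: "nat \<Rightarrow> nat"
  proof -
    have "\<exists>u\<in>N ?d. \<exists>v\<in>N ?e. vdiff (R V) (?P ! i l) (?P ! j l) ! a l = u \<oplus>\<^bsub>R V\<^esub> v"
      if "l \<le> 2" for l using split i a that by blast
    then obtain u v where uv: "\<And>l. l \<le> 2 \<Longrightarrow> u l \<in> N ?d \<and> v l \<in> N ?e \<and>
      vdiff (R V) (?P ! i l) (?P ! j l) ! a l = u l \<oplus>\<^bsub>R V\<^esub> v l"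
      by metis
    have c: "u l \<oplus>\<^bsub>R V\<^esub> v l \<in> carrier (R V)" if "l \<le> 2" for l
      using uv[OF that] N(1)[OF q] N(1)[OF s] by auto
    have "(\<Otimes>\<^bsub>R V\<^esub>l\<in>{..2}. vdiff (R V) (?P ! i l) (?P ! j l) ! a l) =
      (u 0 \<oplus>\<^bsub>R V\<^esub> v 0) \<otimes>\<^bsub>R V\<^esub> (u 1 \<oplus>\<^bsub>R V\<^esub> v 1) \<otimes>\<^bsub>R V\<^esub> (u 2 \<oplus>\<^bsub>R V\<^esub> v 2)"
      using uv c by (subst finprod_three) auto
    also have "\<dots> = \<zero>\<^bsub>R V\<^esub>"
      by (rule prod_of_split_vanishes[where ?N1.0 = "N ?d" and ?N2.0 = "N ?e"])
        (use uv N[OF q] N[OF s] in auto)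
    finally show ?thesis .
  qed
  have P: "?P ! i \<in> vectors (R V) n" if "i < 3" for i
    using that pqs by (auto simp: less_Suc_eq numeral_3_eq_3)
  have vd: "vdiff (R V) (?P ! i) (?P ! j) \<in> pts (Dk C R 2 n) V" if "i < 3" "j < 3" for i j
    using triple[of "\<lambda>_. i" "\<lambda>_. j"] that vdiff_closed[OF P P] unfolding pts_Dk by simp
  have "map (\<lambda>l. vdiff (R V) (?P ! i l) (?P ! j l)) [0..<2 + 1] \<in> pts (DN C R 2 n) V"
    if ij: "\<forall>l\<le>2. i l < 3 \<and> j l < 3 \<and> i l \<noteq> j l" for i j :: "nat \<Rightarrow> nat"
  proof (rule DN_intro[OF V])
    show "set (map (\<lambda>l. vdiff (R V) (?P ! i l) (?P ! j l)) [0..<2 + 1]) \<subseteq> pts (Dk C R 2 n) V"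
      using vd ij by auto
    fix a :: "nat \<Rightarrow> nat" assume a: "\<And>l. l \<le> 2 \<Longrightarrow> a l < n"
    have "(\<Otimes>\<^bsub>R V\<^esub>l\<in>{..2}. map (\<lambda>l. vdiff (R V) (?P ! i l) (?P ! j l)) [0..<2 + 1] ! l ! a l) =
      (\<Otimes>\<^bsub>R V\<^esub>l\<in>{..2}. vdiff (R V) (?P ! i l) (?P ! j l) ! a l)"
    proof (rule finprod_cong')
      show "(\<lambda>l. vdiff (R V) (?P ! i l) (?P ! j l) ! a l) \<in> {..2} \<rightarrow> carrier (R V)"
      proof
        fix l :: nat assume "l \<in> {..2}"
        then have l: "l \<le> 2" by simp
        show "vdiff (R V) (?P ! i l) (?P ! j l) ! a l \<in> carrier (R V)"
          using vdiff_closed[OF P P, of "i l" "j l"] ij a l by (simp add: vectors_iff)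
      qed
      show "map (\<lambda>l. vdiff (R V) (?P ! i l) (?P ! j l)) [0..<2 + 1] ! l ! a l =
        vdiff (R V) (?P ! i l) (?P ! j l) ! a l" if "l \<in> {..2}" for l
        using that by (subst nth_map) (auto simp del: upt_Suc)
    qed simp
    then show "(\<Otimes>\<^bsub>R V\<^esub>l\<in>{..2}. map (\<lambda>l. vdiff (R V) (?P ! i l) (?P ! j l)) [0..<2 + 1] ! l ! a l)
        = \<zero>\<^bsub>R V\<^esub>"
      using triple[of i j a] ij a by simp
  qed simp
  then show ?thesis
    using pqs unfolding Rn_nbhd_def subspace_def by (simp add: power_space_def pts_Rn)
qed

lemma Rn_nbhdD:
  assumes "Ps \<in> pts (Rn_nbhd C R n k p) V" "2 \<le> p"
    and "\<forall>l\<le>k. i l < p \<and> j l < p \<and> i l \<noteq> j l"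
  shows "map (\<lambda>l. vdiff (R V) (Ps ! i l) (Ps ! j l)) [0..<k + 1] \<in> pts (DN C R k n) V"
  using assms unfolding Rn_nbhd_def subspace_def by simp

lemma first_order_neighboursD:
  assumes "first_order_neighbours C R n A V P Q"
  shows "P \<in> Hom C V A" and "Q \<in> Hom C V A"
    and "locally_exists C V (\<lambda>g. \<exists>q \<iota> \<phi> wP wQ. chart C R n A (Dom C g) q \<iota> \<phi> \<and>
      neighbours_in_chart C R n q \<iota> \<phi> (Ident C (Dom C g)) (P \<cdot> g) (Q \<cdot> g) wP wQ)"
proof -
  have mem: "[P, Q] \<in> pts (nbhd C R n A 1 2) V"
    using assms by (simp add: first_order_neighbours_def)
  then show "P \<in> Hom C V A" "Q \<in> Hom C V A"
    by (simp_all add: nbhd_def subspace_def power_space_def object_def)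
  have le: "locally_exists C V (\<lambda>g. \<exists>q \<iota> \<phi>. chart C R n A (Dom C g) q \<iota> \<phi> \<and>
      (\<exists>ws\<in>pts (power_space (object C (Dom C q)) 2) (Dom C g).
        (\<forall>w\<in>set ws. q \<cdot> w = Ident C (Dom C g)) \<and>
        map (\<lambda>w. \<iota> \<cdot> w) ws = res (power_space (object C A) 2) [P, Q] g \<and>
        map (\<lambda>w. res (Rn C R n) \<phi> w) ws \<in> pts (Rn_nbhd C R n 1 2) (Dom C g)))"
    using mem by (simp add: nbhd_def subspace_def)
  show "locally_exists C V (\<lambda>g. \<exists>q \<iota> \<phi> wP wQ. chart C R n A (Dom C g) q \<iota> \<phi> \<and>
      neighbours_in_chart C R n q \<iota> \<phi> (Ident C (Dom C g)) (P \<cdot> g) (Q \<cdot> g) wP wQ)"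
  proof (rule locally_exists_mono[OF le], elim exE conjE bexE)
    fix g q \<iota> \<phi> ws
    let ?W = "Dom C g"
    assume g: "g \<in> into C V" and ch: "chart C R n A ?W q \<iota> \<phi>"
      and ws: "ws \<in> pts (power_space (object C (Dom C q)) 2) ?W"
      and q: "\<forall>w\<in>set ws. q \<cdot> w = Ident C ?W"
      and \<iota>: "map (\<lambda>w. \<iota> \<cdot> w) ws = res (power_space (object C A) 2) [P, Q] g"
      and \<phi>: "map (\<lambda>w. res (Rn C R n) \<phi> w) ws \<in> pts (Rn_nbhd C R n 1 2) ?W"
    obtain wP wQ where w: "ws = [wP, wQ]"
      using ws by (auto simp: power_space_def numeral_2_eq_2 length_Suc_conv)
    have id: "Dom C (Ident C ?W) = ?W" using Ident_into(2) into_Ob[OF g] by simp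
    have "map (\<lambda>l. vdiff (R ?W) (map (\<lambda>w. res (Rn C R n) \<phi> w) ws ! 1)
        (map (\<lambda>w. res (Rn C R n) \<phi> w) ws ! 0)) [0..<1 + 1] \<in> pts (DN C R 1 n) ?W"
      by (rule Rn_nbhdD[OF \<phi>]) auto
    then have "vdiff (R ?W) (res (Rn C R n) \<phi> wQ) (res (Rn C R n) \<phi> wP) \<in> pts (Dk C R 1 n) ?W"
      by (simp add: w DN_def subspace_def power_space_def)
    then have "neighbours_in_chart C R n q \<iota> \<phi> (Ident C ?W) (P \<cdot> g) (Q \<cdot> g) wP wQ"
      using ws q \<iota> unfolding neighbours_in_chart_def w id
      by (simp add: power_space_def object_def)
    then show "\<exists>q \<iota> \<phi> wP wQ. chart C R n A ?W q \<iota> \<phi> \<and>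
      neighbours_in_chart C R n q \<iota> \<phi> (Ident C ?W) (P \<cdot> g) (Q \<cdot> g) wP wQ"
      using ch by blast
  qed
qed

end

locale ring_in_topos = elementary_topos C + ring_in_category C R
  for C :: "('o, 'a) cat" (structure) and R :: "'o \<Rightarrow> 'a ring"
begin

text \<open>
  The two neighbourhood relations come with two different charts, at two different stages.  The bind
  rule brings them to a common stage, and \<open>chart_transfer\<close> moves \<open>Q\<close> into the chart that contains \<open>P\<close>
  and \<open>S\<close>.
\<close>

lemma nbhd_triple:
  assumes KL: "kock_lawvere C R"
    and PQ: "first_order_neighbours C R n A V P Q" and PS: "first_order_neighbours C R n A V P S"
  shows "[P, Q, S] \<in> pts (nbhd C R n A 2 3) V"
proof -
  note P = first_order_neighboursD(1)[OF PQ] and Q = first_order_neighboursD(2)[OF PQ]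
    and S = first_order_neighboursD(2)[OF PS]
  let ?good = "\<lambda>g. \<exists>q \<iota> \<phi>. chart C R n A (Dom C g) q \<iota> \<phi> \<and>
      (\<exists>ws\<in>pts (power_space (object C (Dom C q)) 3) (Dom C g).
        (\<forall>w\<in>set ws. q \<cdot> w = Ident C (Dom C g)) \<and>
        map (\<lambda>w. \<iota> \<cdot> w) ws = res (power_space (object C A) 3) [P, Q, S] g \<and>
        map (\<lambda>w. res (Rn C R n) \<phi> w) ws \<in> pts (Rn_nbhd C R n 2 3) (Dom C g))"
  have "locally_exists C V ?good"
  proof (rule locally_exists_bind[OF first_order_neighboursD(3)[OF PQ]], elim exE conjE)
    fix h q \<iota> \<phi> wP wQ
    assume h: "h \<in> into C V" and ch: "chart C R n A (Dom C h) q \<iota> \<phi>"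
      and nb: "neighbours_in_chart C R n q \<iota> \<phi> (Ident C (Dom C h)) (P \<cdot> h) (Q \<cdot> h) wP wQ"
    have hHom: "h \<in> Hom C (Dom C h) V" using h by (simp add: into_iff_Hom)
    have H: "Dom C h \<in> Ob C" using into_Ob[OF h] by simp
    show "locally_exists C (Dom C h) (\<lambda>k. ?good (h \<cdot> k))"
    proof (rule locally_exists_mono[OF locally_exists_restrict[OF first_order_neighboursD(3)[OF PS] h]],
        elim exE conjE)
      fix k q' \<iota>' \<phi>' wP' wS'
      let ?W = "Dom C k"
      assume k: "k \<in> into C (Dom C h)"
        and "chart C R n A (Dom C (h \<cdot> k)) q' \<iota>' \<phi>'"
        and "neighbours_in_chart C R n q' \<iota>' \<phi>' (Ident C (Dom C (h \<cdot> k)))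
          (P \<cdot> (h \<cdot> k)) (S \<cdot> (h \<cdot> k)) wP' wS'"
      note hk = Comp_into[OF h k]
      then have ch': "chart C R n A ?W q' \<iota>' \<phi>'"
        and nb': "neighbours_in_chart C R n q' \<iota>' \<phi>' (Ident C ?W) (P \<cdot> (h \<cdot> k)) (S \<cdot> (h \<cdot> k)) wP' wS'"
        using \<open>chart C R n A (Dom C (h \<cdot> k)) q' \<iota>' \<phi>'\<close>
          \<open>neighbours_in_chart C R n q' \<iota>' \<phi>' (Ident C (Dom C (h \<cdot> k)))
            (P \<cdot> (h \<cdot> k)) (S \<cdot> (h \<cdot> k)) wP' wS'\<close> by simp_all
      have W: "?W \<in> Ob C" using into_Ob[OF k] by simp
      note I = Ident_into[OF W]
      have kHom: "k \<in> Hom C ?W (Dom C h)" using k by (simp add: into_iff_Hom)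
      have emb: "q \<in> into C (Dom C h)" "\<iota> \<in> Hom C (Dom C q) A" "\<phi> \<in> vectors (R (Dom C q)) n"
        using ch by (simp_all add: chart_def formally_open_def embedding_def object_def pts_Rn)
      have "neighbours_in_chart C R n q \<iota> \<phi> (Ident C (Dom C h) \<cdot> k)
          (P \<cdot> h \<cdot> k) (Q \<cdot> h \<cdot> k) (wP \<cdot> k) (wQ \<cdot> k)"
        using neighbours_in_chart_restrict[OF emb nb] k Ident_into(2)[OF H] by simp
      then have "neighbours_in_chart C R n q \<iota> \<phi> k (P \<cdot> (h \<cdot> k)) (Q \<cdot> (h \<cdot> k)) (wP \<cdot> k) (wQ \<cdot> k)"
        using Ident_left[OF kHom] Comp_assoc[OF P hHom kHom] Comp_assoc[OF Q hHom kHom] by simp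
      moreover have "wP' \<in> Hom C ?W (Dom C q')" "q' \<cdot> wP' = Ident C ?W" "\<iota>' \<cdot> wP' = P \<cdot> (h \<cdot> k)"
        using nb' I(2) by (simp_all add: neighbours_in_chart_def)
      ultimately obtain wQ' where
        nbQ: "neighbours_in_chart C R n q' \<iota>' \<phi>' (Ident C ?W) (P \<cdot> (h \<cdot> k)) (Q \<cdot> (h \<cdot> k)) wP' wQ'"
        using chart_transfer[OF KL ch k _ ch'] by blast
      have \<phi>': "\<phi>' \<in> vectors (R (Dom C q')) n"
        using ch' by (simp add: chart_def formally_open_def embedding_def pts_Rn)
      have w: "w \<in> Hom C ?W (Dom C q')" "q' \<cdot> w = Ident C ?W" if "w \<in> {wP', wQ', wS'}" for w
        using that nb' nbQ I(2) by (auto simp: neighbours_in_chart_def)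
      have v: "res (Rn C R n) \<phi>' w \<in> vectors (R ?W) n" if "w \<in> {wP', wQ', wS'}" for w
        using vectors_restrict[OF Hom_into[OF w(1)[OF that]] \<phi>'] Hom_Dom[OF w(1)[OF that]]
        by (simp add: res_Rn)
      have "[res (Rn C R n) \<phi>' wP', res (Rn C R n) \<phi>' wQ', res (Rn C R n) \<phi>' wS']
          \<in> pts (Rn_nbhd C R n 2 3) ?W"
        by (rule Rn_nbhd_triple[OF W]) (use v nb' nbQ I(2) in \<open>simp_all add: neighbours_in_chart_def\<close>)
      then show "?good (h \<cdot> k)"
        unfolding hk(2) using ch' w nb' nbQ
        by (intro exI[of _ q'] exI[of _ \<iota>'] exI[of _ \<phi>'] conjI bexI[of _ "[wP', wQ', wS']"])
          (auto simp: power_space_def object_def neighbours_in_chart_def)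
    qed
  qed
  then show ?thesis
    using P Q S by (simp add: nbhd_def subspace_def power_space_def object_def)
qed

end

section \<open>The parallelogram connection\<close>

context ring_in_category
begin

lemma pts_weights:
  "a \<in> pts (weights C R p) W \<longleftrightarrow>
    a \<in> vectors (R W) p \<and> (\<Oplus>\<^bsub>R W\<^esub>j\<in>{..<p}. a ! j) = \<one>\<^bsub>R W\<^esub>"
  by (auto simp: weights_def subspace_def pts_Rn)

text \<open>
  A list of members of \<open>Ps\<close>, with repetitions allowed, is a list of combinations of \<open>Ps\<close> by the
  projection law.  The neighbourhood and associativity laws then apply to it.
\<close>

lemma i_affine_reindex:
  assumes op: "i_affine_structure C R A Ap V op" and g: "g \<in> into C V"
    and Ps: "Ps \<in> pts (Ap p) (Dom C g)" and js: "set js \<subseteq> {..<p}"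
  shows "map ((!) Ps) js \<in> pts (Ap (length js)) (Dom C g)"
    and "\<mu> \<in> pts (weights C R (length js)) (Dom C g) \<Longrightarrow>
      op (length js) g (\<mu>, map ((!) Ps) js) =
      op p g (combine (R (Dom C g)) p \<mu> (map (unit_vector (R (Dom C g)) p) js), Ps)"
proof -
  interpret plain_cring "R (Dom C g)" using into_Ob[OF g] R_cring by blast
  let ?ls = "map (unit_vector (R (Dom C g)) p) js"
  have ls: "?ls \<in> pts (power_space (weights C R p) (length js)) (Dom C g)"
    using js unit_vector_weights by (auto simp: power_space_def pts_weights subset_iff)
  have "op p g (unit_vector (R (Dom C g)) p j, Ps) = Ps ! j" if "j < p" for j
    using op g Ps that unfolding i_affine_structure_def by blast
  then have eq: "map (\<lambda>l. op p g (l, Ps)) ?ls = map ((!) Ps) js"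
    using js by (auto simp: subset_iff)
  have "map (\<lambda>l. op p g (l, Ps)) ?ls \<in> pts (Ap (length js)) (Dom C g)"
    using op g ls Ps unfolding i_affine_structure_def by blast
  then show "map ((!) Ps) js \<in> pts (Ap (length js)) (Dom C g)" unfolding eq .
  assume "\<mu> \<in> pts (weights C R (length js)) (Dom C g)"
  then have "op (length js) g (\<mu>, map (\<lambda>l. op p g (l, Ps)) ?ls) =
      op p g (combine (R (Dom C g)) p \<mu> ?ls, Ps)"
    using op g ls Ps unfolding i_affine_structure_def by blast
  then show "op (length js) g (\<mu>, map ((!) Ps) js) =
      op p g (combine (R (Dom C g)) p \<mu> ?ls, Ps)" unfolding eq .
qed

text \<open>
  The weights for which the combination of \<open>(P, Q, S)\<close> is the fourth vertex \<open>Q + S - P\<close> of a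
  parallelogram.
\<close>

definition parallelogram_weights :: "'o \<Rightarrow> 'a list" where
  "parallelogram_weights W = [\<ominus>\<^bsub>R W\<^esub> \<one>\<^bsub>R W\<^esub>, \<one>\<^bsub>R W\<^esub>, \<one>\<^bsub>R W\<^esub>]"

text \<open>
  For the points \<open>A\<^sub>0, A\<^sub>1, A\<^sub>2\<close> of a triple, the last three equations say \<open>A\<^sub>1 + A\<^sub>0 - A\<^sub>0 = A\<^sub>1\<close>,
  \<open>A\<^sub>0 + A\<^sub>1 - A\<^sub>0 = A\<^sub>1\<close> and \<open>A\<^sub>2 + A\<^sub>1 - A\<^sub>0 = A\<^sub>1 + A\<^sub>2 - A\<^sub>0\<close>: the two unit laws and the symmetry of the
  connection.
\<close>

lemma parallelogram_weights:
  assumes W: "W \<in> Ob C"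
  shows "parallelogram_weights W \<in> pts (weights C R 3) W"
    and "combine (R W) 3 (parallelogram_weights W) (map (unit_vector (R W) 3) [0, 1, 0]) =
      unit_vector (R W) 3 1"
    and "combine (R W) 3 (parallelogram_weights W) (map (unit_vector (R W) 3) [0, 0, 1]) =
      unit_vector (R W) 3 1"
    and "combine (R W) 3 (parallelogram_weights W) (map (unit_vector (R W) 3) [0, 2, 1]) =
      parallelogram_weights W"
proof -
  interpret plain_cring "R W" using W by (rule R_cring)
  let ?l = "parallelogram_weights W"
  show "?l \<in> pts (weights C R 3) W"
    unfolding pts_weights
    by (subst finsum_three) (auto simp: parallelogram_weights_def vectors_def l_neg)
  have upt: "[0..<3] = [0, 1, 2::nat]" by (simp add: upt_rec numeral_3_eq_3)
  have combine: "combine (R W) 3 ?l (map (unit_vector (R W) 3) [a, b, c]) =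
    map (\<lambda>j. \<ominus>\<^bsub>R W\<^esub> (unit_vector (R W) 3 a ! j) \<oplus>\<^bsub>R W\<^esub> unit_vector (R W) 3 b ! j
      \<oplus>\<^bsub>R W\<^esub> unit_vector (R W) 3 c ! j) [0, 1, 2]" for a b c
  proof -
    have u: "unit_vector (R W) 3 i ! j \<in> carrier (R W)" if "j < 3" for i j
      using that by (simp add: unit_vector_def)
    have len: "length (map (unit_vector (R W) 3) [a, b, c]) = 3" by simp
    have "combine (R W) 3 ?l (map (unit_vector (R W) 3) [a, b, c]) =
      map (\<lambda>j. \<Oplus>\<^bsub>R W\<^esub>k\<in>{..<3}. ?l ! k \<otimes>\<^bsub>R W\<^esub> (map (unit_vector (R W) 3) [a, b, c] ! k) ! j) [0, 1, 2]"
      unfolding combine_def upt len ..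
    also have "\<dots> = map (\<lambda>j. \<ominus>\<^bsub>R W\<^esub> (unit_vector (R W) 3 a ! j) \<oplus>\<^bsub>R W\<^esub> unit_vector (R W) 3 b ! j
      \<oplus>\<^bsub>R W\<^esub> unit_vector (R W) 3 c ! j) [0, 1, 2]"
    proof (rule map_cong[OF refl])
      fix j :: nat assume "j \<in> set [0, 1, 2]"
      then have "j < 3" by auto
      then show "(\<Oplus>\<^bsub>R W\<^esub>k\<in>{..<3}. ?l ! k \<otimes>\<^bsub>R W\<^esub> (map (unit_vector (R W) 3) [a, b, c] ! k) ! j) =
        \<ominus>\<^bsub>R W\<^esub> (unit_vector (R W) 3 a ! j) \<oplus>\<^bsub>R W\<^esub> unit_vector (R W) 3 b ! j
        \<oplus>\<^bsub>R W\<^esub> unit_vector (R W) 3 c ! j"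
        using u by (subst finsum_three) (simp_all add: parallelogram_weights_def l_minus)
    qed
    finally show ?thesis .
  qed
  show "combine (R W) 3 ?l (map (unit_vector (R W) 3) [0, 1, 0]) = unit_vector (R W) 3 1"
    "combine (R W) 3 ?l (map (unit_vector (R W) 3) [0, 0, 1]) = unit_vector (R W) 3 1"
    "combine (R W) 3 ?l (map (unit_vector (R W) 3) [0, 2, 1]) = ?l"
    unfolding combine
    by (simp_all add: unit_vector_def upt parallelogram_weights_def l_neg)
qed

lemma restrict_parallelogram_weights:
  assumes g: "g \<in> into C W"
  shows "map (\<lambda>x. x \<cdot> g) (parallelogram_weights W) = parallelogram_weights (Dom C g)"
proof -
  interpret ring_hom_cring "R W" "R (Dom C g)" "\<lambda>x. x \<cdot> g" using g by (rule R_hom)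
  show ?thesis by (simp add: parallelogram_weights_def)
qed

end

lemma (in ring_in_topos) symmetric_connection_exists:
  assumes KL: "kock_lawvere C R" and op: "i_affine_structure C R A (nbhd C R n A 2) V op"
  shows "\<exists>\<Lambda>. affine_connection C R n A V \<Lambda> \<and> symmetric_connection C R n A V \<Lambda>"
proof -
  define \<Lambda> where "\<Lambda> = (\<lambda>g (P, Q, S). op 3 g (parallelogram_weights (Dom C g), [P, Q, S]))"
  have op3: "op 3 \<in> maps C V (prod_space (weights C R 3) (nbhd C R n A 2 3)) (object C A)"
    using op by (simp add: i_affine_structure_def)
  have reindex: "op 3 g (parallelogram_weights (Dom C g), map ((!) Ps) [a, b, c]) =
      op 3 g (combine (R (Dom C g)) 3 (parallelogram_weights (Dom C g))
        (map (unit_vector (R (Dom C g)) 3) [a, b, c]), Ps)"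
    if "g \<in> into C V" "Ps \<in> pts (nbhd C R n A 2 3) (Dom C g)" "{a, b, c} \<subseteq> {..<3}" for g Ps a b c
    using i_affine_reindex(2)[OF op that(1,2), of "[a, b, c]" "parallelogram_weights (Dom C g)"]
      that(3) parallelogram_weights(1) into_Ob(1)[OF that(1)] by (simp add: numeral_3_eq_3)
  have vertex: "op 3 g (unit_vector (R (Dom C g)) 3 1, Ps) = Ps ! 1"
    if "g \<in> into C V" "Ps \<in> pts (nbhd C R n A 2 3) (Dom C g)" for g Ps
    using op that unfolding i_affine_structure_def by force
  have "\<Lambda> \<in> maps C V (connection_domain C R n A) (object C A)"
    unfolding maps_def
  proof (intro CollectI ballI conjI)
    fix g x assume g: "g \<in> into C V" and x: "x \<in> pts (connection_domain C R n A) (Dom C g)"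
    obtain P Q S where x': "x = (P, Q, S)" by (metis prod_cases3)
    then have "[P, Q, S] \<in> pts (nbhd C R n A 2 3) (Dom C g)"
      using x nbhd_triple[OF KL] by (simp add: connection_domain_def subspace_def)
    then have dom: "(parallelogram_weights (Dom C g), [P, Q, S]) \<in>
        pts (prod_space (weights C R 3) (nbhd C R n A 2 3)) (Dom C g)"
      using parallelogram_weights(1) into_Ob(1)[OF g] by (simp add: prod_space_def)
    show "\<Lambda> g x \<in> pts (object C A) (Dom C g)"
      using maps_closed[OF op3 g dom] by (simp add: \<Lambda>_def x')
    fix h assume h: "h \<in> into C (Dom C g)"
    show "\<Lambda> (g \<cdot> h) (res (connection_domain C R n A) x h) = res (object C A) (\<Lambda> g x) h"
      using maps_natural[OF op3 g dom h] restrict_parallelogram_weights[OF h] Comp_into(2)[OF g h]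
      by (simp add: \<Lambda>_def x' connection_domain_def subspace_def prod_space_def object_def
          weights_def nbhd_def power_space_def res_Rn)
  qed
  moreover have "\<Lambda> g (P, Q, P) = Q" and "\<Lambda> g (P, P, Q) = Q"
    if g: "g \<in> into C V" and PQ: "first_order_neighbours C R n A (Dom C g) P Q" for g P Q
  proof -
    have W: "Dom C g \<in> Ob C" using into_Ob[OF g] by simp
    \<comment> \<open>Both \<open>(P, Q, P)\<close> and \<open>(P, P, Q)\<close> are reindexings of this triple.\<close>
    have Ps: "[P, Q, Q] \<in> pts (nbhd C R n A 2 3) (Dom C g)" by (rule nbhd_triple[OF KL PQ PQ])
    show "\<Lambda> g (P, Q, P) = Q"
      using reindex[OF g Ps, of 0 1 0] vertex[OF g Ps] parallelogram_weights(2)[OF W]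
      by (simp add: \<Lambda>_def)
    show "\<Lambda> g (P, P, Q) = Q"
      using reindex[OF g Ps, of 0 0 1] vertex[OF g Ps] parallelogram_weights(3)[OF W]
      by (simp add: \<Lambda>_def)
  qed
  moreover have "\<Lambda> g (P, Q, S) = \<Lambda> g (P, S, Q)"
    if g: "g \<in> into C V" and dom: "(P, Q, S) \<in> pts (connection_domain C R n A) (Dom C g)" for g P Q S
  proof -
    have W: "Dom C g \<in> Ob C" using into_Ob[OF g] by simp
    have Ps: "[P, Q, S] \<in> pts (nbhd C R n A 2 3) (Dom C g)"
      using dom nbhd_triple[OF KL] by (simp add: connection_domain_def subspace_def)
    show ?thesis
      using reindex[OF g Ps, of 0 2 1] parallelogram_weights(4)[OF W] by (simp add: \<Lambda>_def)
  qed
  ultimately show ?thesis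
    unfolding affine_connection_def symmetric_connection_def by blast
qed

theorem proposition1:
  fixes C :: "('o, 'a) cat" and R :: "'o \<Rightarrow> 'a ring" and n :: nat and A V :: 'o
  assumes "elementary_topos C"
    and "ring_object C R" and "rat_algebra C R" and "kock_lawvere C R"
    and "V \<in> Ob C"
    and "formal_manifold C R n A V"
    and "\<exists>op. i_affine_structure C R A (nbhd C R n A 2) V op"
  shows "\<exists>\<Lambda>. affine_connection C R n A V \<Lambda> \<and> symmetric_connection C R n A V \<Lambda>"
proof -
  interpret elementary_topos C by fact
  interpret ring_in_topos C R by unfold_locales fact
  show ?thesis using assms(4,7) symmetric_connection_exists by blast
qed

end
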